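(* Let $G(t)$, $t\in\mathbb{R}$, be a strongly continuous one parameter group in $\mathbb{G}$, let $U_{G(t)}$ be the associated strongly continuous one parameter group of unitaries on $H^1_0$, and let $S:D(S)\subset H^1_0\to H^1_0$ be the (possibly unbounded) self-adjoint operator with $U_{G(t)}=e^{itS}$. Let $D\subset H^1_0$ be the linear span of the vectors $f_\varphi=\int_{-\infty}^\infty\varphi(t)G(t)f\,dt$ with $f\in H^1_0$ and $\varphi\in C_0^\infty(\mathbb{R})$. Then the following assertions hold: (i) The subspace $D$ is dense in $H^1_0$, satisfies $G(t)(D)\subset D$ for all $t\in\mathbb{R}$, and for $f\in D$ the map $t\mapsto G(t)f$ is differentiable. (ii) The subspace $A^{1/2}(D)$ is dense in $H^1_0$, satisfies $U_{G(t)}(A^{1/2}(D))\subset A^{1/2}(D)$, and for $f\in A^{1/2}(D)$ the map $t\mapsto U_{G(t)}f$ is differentiable. (iii) $S(A^{1/2}(D))\subset A^{1/2}(D)$, $A^{1/2}(D)$ is a core for $S$, and if $f\in D$, then $iSA^{1/2}f=A^{1/2}\dot G(0)f$.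
   Context: Let $\Omega\subset\mathbb{R}^n$ be open, $L^2=L^2(\Omega,dx)$ the complex Lebesgue space with its usual inner product $\langle\cdot,\cdot\rangle$, and $H^1_0=H^1_0(\Omega)$ the closure in the Sobolev norm of the complex-valued $C^\infty$ functions with compact support in $\Omega$, a Hilbert space with inner product $[f,g]=\int_\Omega f\bar g\,dx+\int_\Omega\nabla f\cdot\nabla\bar g\,dx$. $Gl(H^1_0)$ is the group of invertible bounded operators on $H^1_0$. $\mathbb{G}=\{G\in Gl(H^1_0):\langle Gf,Gg\rangle=\langle f,g\rangle\ \text{for all } f,g\in H^1_0\}$. $A\in\mathcal{B}(H^1_0)$ is the positive operator determined by $[Af,g]=\langle f,g\rangle$ for all $f,g\in H^1_0$, and $A^{1/2}$ is its positive square root in $\mathcal{B}(H^1_0)$. For $G\in\mathbb{G}$, $U_G$ is the unique unitary operator on $(H^1_0,[\cdot,\cdot])$ such that $U_GA^{1/2}=A^{1/2}G$. A strongly continuous one parameter group in $\mathbb{G}$ is a family $G(t)\in\mathbb{G}$, $t\in\mathbb{R}$, with $G(0)=1$, $G(t+s)=G(t)G(s)$, and $t\mapsto G(t)f\in H^1_0$ continuous for each $f\in H^1_0$. In this case $U_{G(t)}$ is a strongly continuous one parameter group of unitaries on $H^1_0$, so $S$ exists by Stone's theorem. $C_0^\infty(\mathbb{R})$ is the space of smooth functions with compact support on $\mathbb{R}$. For $f\in D$, $\dot G(0)f$ is the derivative of $t\mapsto G(t)f$ at $t=0$ in $H^1_0$. *)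

theory Defs
  imports "HOL-Analysis.Analysis"
begin

section \<open>Complex inner product spaces\<close>

text \<open>A complex inner product, linear in the first argument, whose real part is the inner product
  of the library; hence norm, topology, derivatives and integrals are those of the library.\<close>

class complex_inner = real_inner +
  fixes scaleC :: "complex \<Rightarrow> 'a \<Rightarrow> 'a"  (infixr \<open>*\<^sub>C\<close> 75)
    and cinner :: "'a \<Rightarrow> 'a \<Rightarrow> complex"
  assumes scaleC_add_right: "a *\<^sub>C (x + y) = a *\<^sub>C x + a *\<^sub>C y"
    and scaleC_add_left: "(a + b) *\<^sub>C x = a *\<^sub>C x + b *\<^sub>C x"
    and scaleC_scaleC: "a *\<^sub>C b *\<^sub>C x = (a * b) *\<^sub>C x"
    and scaleR_eq_scaleC: "r *\<^sub>R x = of_real r *\<^sub>C x"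
    and cinner_commute: "cinner x y = cnj (cinner y x)"
    and cinner_add_left: "cinner (x + y) z = cinner x z + cinner y z"
    and cinner_scaleC_left: "cinner (a *\<^sub>C x) y = a * cinner x y"
    and inner_eq_Re_cinner: "inner x y = Re (cinner x y)"

instantiation prod :: (complex_inner, complex_inner) complex_inner
begin

definition scaleC_prod_def: "a *\<^sub>C p = (a *\<^sub>C fst p, a *\<^sub>C snd p)"

definition cinner_prod_def: "cinner p q = cinner (fst p) (fst q) + cinner (snd p) (snd q)"

instance
proof
  fix p q :: "'a \<times> 'b"
  show "cinner p q = cnj (cinner q p)"
    unfolding cinner_prod_def complex_cnj_add
    by (simp add: cinner_commute[symmetric])
qed (simp_all add: scaleC_prod_def cinner_prod_def prod_eq_iff scaleC_add_right scaleC_add_left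
      scaleC_scaleC scaleR_eq_scaleC cinner_add_left cinner_scaleC_left inner_eq_Re_cinner
      inner_prod_def algebra_simps)

end

instantiation vec :: (complex_inner, finite) complex_inner
begin

definition scaleC_vec_def: "a *\<^sub>C v = (\<chi> i. a *\<^sub>C (v $ i))"

definition cinner_vec_def: "cinner v w = (\<Sum>i\<in>UNIV. cinner (v $ i) (w $ i))"

instance
proof
  fix p q :: "'a ^ 'b"
  show "cinner p q = cnj (cinner q p)"
    unfolding cinner_vec_def cnj_sum
    by (simp add: cinner_commute[symmetric])
qed (simp_all add: scaleC_vec_def cinner_vec_def vec_eq_iff scaleC_add_right scaleC_add_left
      scaleC_scaleC scaleR_eq_scaleC cinner_add_left cinner_scaleC_left inner_eq_Re_cinner
      inner_vec_def sum.distrib sum_distrib_left)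

end


section \<open>Operators on a subspace of a complex inner product space\<close>

text \<open>An operator on a subspace \<open>H\<close> is a total function of which only the values on \<open>H\<close> (or on
  its domain, for unbounded operators) matter.\<close>

definition csubspace :: "'a::complex_inner set \<Rightarrow> bool" where
  "csubspace V \<longleftrightarrow> 0 \<in> V \<and> (\<forall>x\<in>V. \<forall>y\<in>V. x + y \<in> V) \<and> (\<forall>a. \<forall>x\<in>V. a *\<^sub>C x \<in> V)"

definition cspan :: "'a::complex_inner set \<Rightarrow> 'a set" where
  "cspan B = csubspace hull B"

definition dense_in :: "'a::topological_space set \<Rightarrow> 'a set \<Rightarrow> bool" where
  "dense_in H V \<longleftrightarrow> V \<subseteq> H \<and> H \<subseteq> closure V"

definition clinear_from_to :: "'a::complex_inner set \<Rightarrow> 'a set \<Rightarrow> ('a \<Rightarrow> 'a) \<Rightarrow> bool" where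
  "clinear_from_to V H T \<longleftrightarrow> csubspace V \<and> T ` V \<subseteq> H \<and>
     (\<forall>x\<in>V. \<forall>y\<in>V. T (x + y) = T x + T y) \<and> (\<forall>a. \<forall>x\<in>V. T (a *\<^sub>C x) = a *\<^sub>C T x)"

definition bounded_op :: "'a::complex_inner set \<Rightarrow> ('a \<Rightarrow> 'a) \<Rightarrow> bool" where
  "bounded_op H T \<longleftrightarrow> clinear_from_to H H T \<and> (\<exists>K. \<forall>x\<in>H. norm (T x) \<le> K * norm x)"

definition Gl :: "'a::complex_inner set \<Rightarrow> ('a \<Rightarrow> 'a) set" where
  "Gl H = {T. bounded_op H T \<and> (\<exists>T'. bounded_op H T' \<and> (\<forall>x\<in>H. T (T' x) = x \<and> T' (T x) = x))}"

definition positive_op :: "'a::complex_inner set \<Rightarrow> ('a \<Rightarrow> 'a) \<Rightarrow> bool" where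
  "positive_op H T \<longleftrightarrow> bounded_op H T \<and>
     (\<forall>x\<in>H. Im (cinner (T x) x) = 0 \<and> 0 \<le> Re (cinner (T x) x))"

definition positive_sqrt :: "'a::complex_inner set \<Rightarrow> ('a \<Rightarrow> 'a) \<Rightarrow> ('a \<Rightarrow> 'a) \<Rightarrow> bool" where
  "positive_sqrt H T R \<longleftrightarrow> positive_op H R \<and> (\<forall>x\<in>H. R (R x) = T x)"

definition unitary_op :: "'a::complex_inner set \<Rightarrow> ('a \<Rightarrow> 'a) \<Rightarrow> bool" where
  "unitary_op H U \<longleftrightarrow> clinear_from_to H H U \<and> U ` H = H \<and>
     (\<forall>x\<in>H. \<forall>y\<in>H. cinner (U x) (U y) = cinner x y)"

definition strongly_continuous_group ::
    "'a::complex_inner set \<Rightarrow> (real \<Rightarrow> 'a \<Rightarrow> 'a) \<Rightarrow> bool" where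
  "strongly_continuous_group H G \<longleftrightarrow>
     (\<forall>x\<in>H. G 0 x = x) \<and> (\<forall>s t. \<forall>x\<in>H. G (t + s) x = G t (G s x)) \<and>
     (\<forall>x\<in>H. continuous_on UNIV (\<lambda>t. G t x))"

subsection \<open>Unbounded self-adjoint operators\<close>

definition op_graph :: "'a set \<Rightarrow> ('a \<Rightarrow> 'a) \<Rightarrow> ('a \<times> 'a) set" where
  "op_graph V S = {(x, S x) | x. x \<in> V}"

definition adjoint_graph :: "'a::complex_inner set \<Rightarrow> 'a set \<Rightarrow> ('a \<Rightarrow> 'a) \<Rightarrow> ('a \<times> 'a) set" where
  "adjoint_graph H V S = {(y, z). y \<in> H \<and> z \<in> H \<and> (\<forall>x\<in>V. cinner (S x) y = cinner x z)}"

definition selfadjoint_op :: "'a::complex_inner set \<Rightarrow> 'a set \<Rightarrow> ('a \<Rightarrow> 'a) \<Rightarrow> bool" where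
  "selfadjoint_op H V S \<longleftrightarrow> dense_in H V \<and> clinear_from_to V H S \<and>
     adjoint_graph H V S = op_graph V S"

text \<open>The closure is taken in the product space, i.e. in the graph norm; for a closed operator
  this says that \<open>S\<close> is the closure of its restriction to \<open>C\<close>.\<close>

definition is_core :: "'a::complex_inner set \<Rightarrow> 'a set \<Rightarrow> ('a \<Rightarrow> 'a) \<Rightarrow> bool" where
  "is_core C V S \<longleftrightarrow> csubspace C \<and> C \<subseteq> V \<and> closure (op_graph C S) = op_graph V S"

subsection \<open>Spectral calculus\<close>

definition projection_valued_measure ::
    "'a::complex_inner set \<Rightarrow> (real set \<Rightarrow> 'a \<Rightarrow> 'a) \<Rightarrow> bool" where
  "projection_valued_measure H E \<longleftrightarrow>
     (\<forall>B\<in>sets borel. clinear_from_to H H (E B) \<and> (\<forall>x\<in>H. E B (E B x) = E B x) \<and>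
        (\<forall>x\<in>H. \<forall>y\<in>H. cinner (E B x) y = cinner x (E B y))) \<and>
     (\<forall>x\<in>H. E UNIV x = x) \<and>
     (\<forall>B :: nat \<Rightarrow> real set. range B \<subseteq> sets borel \<longrightarrow> disjoint_family B \<longrightarrow>
        (\<forall>x\<in>H. (\<lambda>n. E (B n) x) sums E (\<Union>n. B n) x))"

text \<open>The measure \<open>B \<mapsto> [E(B)x, x]\<close>.\<close>

definition spectral_measure_at ::
    "(real set \<Rightarrow> 'a \<Rightarrow> 'a) \<Rightarrow> 'a::complex_inner \<Rightarrow> real measure" where
  "spectral_measure_at E x =
     measure_of UNIV (sets borel) (\<lambda>B. ennreal (Re (cinner (E B x) x)))"

text \<open>\<open>S = \<integral>\<lambda> dE(\<lambda>)\<close>. Here and in the next definition the operator is specified through its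
  quadratic form, which determines it by polarization.\<close>

definition spectral_resolution ::
    "'a::complex_inner set \<Rightarrow> 'a set \<Rightarrow> ('a \<Rightarrow> 'a) \<Rightarrow> (real set \<Rightarrow> 'a \<Rightarrow> 'a) \<Rightarrow> bool" where
  "spectral_resolution H V S E \<longleftrightarrow> projection_valued_measure H E \<and>
     V = {x\<in>H. integrable (spectral_measure_at E x) (\<lambda>l. l\<^sup>2)} \<and>
     (\<forall>x\<in>V. cinner (S x) x = of_real (\<integral>l. l \<partial>spectral_measure_at E x))"

text \<open>\<open>T = \<integral>\<phi>(\<lambda>) dE(\<lambda>)\<close> for a bounded Borel function \<open>\<phi>\<close>.\<close>

definition spectral_integral ::
    "'a::complex_inner set \<Rightarrow> (real set \<Rightarrow> 'a \<Rightarrow> 'a) \<Rightarrow> (real \<Rightarrow> complex) \<Rightarrow> ('a \<Rightarrow> 'a) \<Rightarrow> bool" where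
  "spectral_integral H E \<phi> T \<longleftrightarrow> bounded_op H T \<and>
     (\<forall>x\<in>H. cinner (T x) x = (\<integral>l. \<phi> l \<partial>spectral_measure_at E x))"

text \<open>\<open>U(t) = e\<^sup>i\<^sup>t\<^sup>S\<close> for all \<open>t\<close>; the spectral measure \<open>E\<close> of \<open>S\<close> is unique.\<close>

definition is_exp_i_group ::
    "'a::complex_inner set \<Rightarrow> 'a set \<Rightarrow> ('a \<Rightarrow> 'a) \<Rightarrow> (real \<Rightarrow> 'a \<Rightarrow> 'a) \<Rightarrow> bool" where
  "is_exp_i_group H V S U \<longleftrightarrow> (\<exists>E. spectral_resolution H V S E \<and>
     (\<forall>t. spectral_integral H E (\<lambda>l. exp (\<i> * of_real (t * l))) (U t)))"


section \<open>Test functions\<close>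

fun Ck :: "nat \<Rightarrow> ('a::euclidean_space \<Rightarrow> complex) \<Rightarrow> bool" where
  "Ck 0 f \<longleftrightarrow> continuous_on UNIV f"
| "Ck (Suc k) f \<longleftrightarrow> (\<forall>x. f differentiable (at x)) \<and>
     (\<forall>b\<in>Basis. Ck k (\<lambda>x. frechet_derivative f (at x) b))"

text \<open>The smooth functions with compact support in \<open>\<Omega>\<close>, extended by zero.\<close>

definition test_functions :: "'a::euclidean_space set \<Rightarrow> ('a \<Rightarrow> complex) set" where
  "test_functions \<Omega> = {\<phi>. (\<forall>k. Ck k \<phi>) \<and> compact (closure {x. \<phi> x \<noteq> 0}) \<and>
     closure {x. \<phi> x \<noteq> 0} \<subseteq> \<Omega>}"


section \<open>The space L2 of complex functions\<close>

text \<open>Every class of Lebesgue measurable functions modulo null sets has a Borel representative, so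
  Borel measurability is no restriction.\<close>

definition sq_integrable :: "('a::euclidean_space \<Rightarrow> complex) \<Rightarrow> bool" where
  "sq_integrable f \<longleftrightarrow> f \<in> borel_measurable lborel \<and> integrable lborel (\<lambda>x. (cmod (f x))\<^sup>2)"

definition l2_eq :: "('a::euclidean_space \<Rightarrow> complex) \<Rightarrow> ('a \<Rightarrow> complex) \<Rightarrow> bool" where
  "l2_eq f g \<longleftrightarrow> sq_integrable f \<and> sq_integrable g \<and> (AE x in lborel. f x = g x)"

lemma sq_integrable_0: "sq_integrable (\<lambda>x. 0)"
  by (simp add: sq_integrable_def)

quotient_type (overloaded) 'a l2 = "'a::euclidean_space \<Rightarrow> complex" / partial: l2_eq
  morphisms rep_l2 l2_class
proof (rule part_equivpI)
  show "\<exists>f. l2_eq f f"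
    using sq_integrable_0 by (auto simp: l2_eq_def)
  show "symp l2_eq"
    by (auto simp: symp_def l2_eq_def elim: eventually_mono)
  show "transp l2_eq"
    by (auto simp: transp_def l2_eq_def elim: eventually_elim2)
qed

lemma borel_measurable_cnj:
  "f \<in> borel_measurable M \<Longrightarrow> (\<lambda>x. cnj (f x)) \<in> borel_measurable M"
  by (rule borel_measurable_continuous_on[where f = cnj]) (auto intro!: continuous_intros)

lemma sq_integrable_mult:
  assumes "sq_integrable f" "sq_integrable g"
  shows "integrable lborel (\<lambda>x. f x * cnj (g x))"
proof (rule Bochner_Integration.integrable_bound)
  show "integrable lborel (\<lambda>x. (cmod (f x))\<^sup>2 + (cmod (g x))\<^sup>2)"
    using assms by (simp add: sq_integrable_def)
  show "(\<lambda>x. f x * cnj (g x)) \<in> borel_measurable lborel"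
    using assms by (auto simp: sq_integrable_def intro!: borel_measurable_times borel_measurable_cnj)
  have "a * b \<le> a\<^sup>2 + b\<^sup>2" if "0 \<le> a" "0 \<le> b" for a b :: real
    using sum_squares_bound[of a b] mult_nonneg_nonneg[OF that] by linarith
  then show "AE x in lborel. norm (f x * cnj (g x)) \<le> norm ((cmod (f x))\<^sup>2 + (cmod (g x))\<^sup>2)"
    by (simp add: norm_mult)
qed

lemma sq_integrable_cmult: "sq_integrable f \<Longrightarrow> sq_integrable (\<lambda>x. c * f x)"
  by (auto simp: sq_integrable_def norm_mult power_mult_distrib)

lemma sq_integrable_add:
  assumes "sq_integrable f" "sq_integrable g"
  shows "sq_integrable (\<lambda>x. f x + g x)"
  unfolding sq_integrable_def
proof
  show "integrable lborel (\<lambda>x. (cmod (f x + g x))\<^sup>2)"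
  proof (rule Bochner_Integration.integrable_bound)
    show "integrable lborel (\<lambda>x. 2 * (cmod (f x))\<^sup>2 + 2 * (cmod (g x))\<^sup>2)"
      using assms by (simp add: sq_integrable_def)
    show "(\<lambda>x. (cmod (f x + g x))\<^sup>2) \<in> borel_measurable lborel"
      using assms by (auto simp: sq_integrable_def)
    have "(cmod (a + b))\<^sup>2 \<le> 2 * (cmod a)\<^sup>2 + 2 * (cmod b)\<^sup>2" for a b
    proof -
      have "(cmod (a + b))\<^sup>2 \<le> (cmod a + cmod b)\<^sup>2"
        by (intro power_mono norm_triangle_ineq) auto
      with sum_squares_bound[of "cmod a" "cmod b"] show ?thesis
        by (simp add: power2_sum)
    qed
    then show "AE x in lborel. norm ((cmod (f x + g x))\<^sup>2) \<le>
        norm (2 * (cmod (f x))\<^sup>2 + 2 * (cmod (g x))\<^sup>2)"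
      by simp
  qed
qed (use assms in \<open>auto simp: sq_integrable_def\<close>)

instantiation l2 :: (euclidean_space) complex_inner
begin

lift_definition zero_l2 :: "'a l2" is "\<lambda>x. 0"
  by (simp add: l2_eq_def sq_integrable_0)

lift_definition plus_l2 :: "'a l2 \<Rightarrow> 'a l2 \<Rightarrow> 'a l2" is "\<lambda>f g x. f x + g x"
  by (auto simp: l2_eq_def sq_integrable_add elim: eventually_elim2)

lift_definition scaleC_l2 :: "complex \<Rightarrow> 'a l2 \<Rightarrow> 'a l2" is "\<lambda>c f x. c * f x"
  by (auto simp: l2_eq_def sq_integrable_cmult elim: eventually_mono)

lift_definition cinner_l2 :: "'a l2 \<Rightarrow> 'a l2 \<Rightarrow> complex" is
  "\<lambda>f g. \<integral>x. f x * cnj (g x) \<partial>lborel"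
  unfolding l2_eq_def
  by (intro integral_cong_AE)
    (auto simp: sq_integrable_def intro!: borel_measurable_times borel_measurable_cnj
      elim: eventually_elim2)

definition "- f = (-1) *\<^sub>C (f :: 'a l2)"
definition "f - g = f + - (g :: 'a l2)"
definition "r *\<^sub>R f = of_real r *\<^sub>C (f :: 'a l2)"
definition "inner f g = Re (cinner f (g :: 'a l2))"
definition "norm f = sqrt (inner f (f :: 'a l2))"
definition "sgn f = inverse (norm f) *\<^sub>R (f :: 'a l2)"
definition "dist f g = norm (f - (g :: 'a l2))"
definition [code del]:
  "(uniformity :: ('a l2 \<times> 'a l2) filter) = (INF e\<in>{0<..}. principal {(x, y). dist x y < e})"
definition [code del]:
  "open (U :: 'a l2 set) \<longleftrightarrow> (\<forall>x\<in>U. eventually (\<lambda>(x', y). x' = x \<longrightarrow> y \<in> U) uniformity)"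

instance
proof
  fix f g h :: "'a l2" and a b :: complex and r s :: real
  show add_comm: "f + g = g + f"
    by transfer (auto simp: l2_eq_def sq_integrable_add add.commute)
  show "f + g + h = f + (g + h)"
    by transfer (auto simp: l2_eq_def sq_integrable_add add.assoc)
  show "0 + f = f"
    by transfer (auto simp: l2_eq_def)
  have scaleC_1: "1 *\<^sub>C f = f" for f :: "'a l2"
    by transfer (auto simp: l2_eq_def)
  have scaleC_0: "0 *\<^sub>C f = 0" for f :: "'a l2"
    by transfer (auto simp: l2_eq_def sq_integrable_0)
  show add_right: "a *\<^sub>C (f + g) = a *\<^sub>C f + a *\<^sub>C g" for a and f g :: "'a l2"
    by transfer (auto simp: l2_eq_def sq_integrable_add sq_integrable_cmult algebra_simps)
  show add_left: "(a + b) *\<^sub>C f = a *\<^sub>C f + b *\<^sub>C f" for a b and f :: "'a l2"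
    by transfer
      (auto simp: l2_eq_def ring_distribs intro!: sq_integrable_add sq_integrable_cmult)
  show scaleC_scaleC: "a *\<^sub>C b *\<^sub>C f = (a * b) *\<^sub>C f" for a b and f :: "'a l2"
    by transfer (auto simp: l2_eq_def mult.assoc intro!: sq_integrable_cmult)
  show "- f + f = 0"
    using add_left[of "-1" 1 f] by (simp add: uminus_l2_def scaleC_1 scaleC_0)
  show "f - g = f + - g"
    by (rule minus_l2_def)
  show "r *\<^sub>R (f + g) = r *\<^sub>R f + r *\<^sub>R g"
    by (simp add: scaleR_l2_def add_right)
  show "(r + s) *\<^sub>R f = r *\<^sub>R f + s *\<^sub>R f"
    by (simp add: scaleR_l2_def add_left)
  show "r *\<^sub>R s *\<^sub>R f = (r * s) *\<^sub>R f"
    by (simp add: scaleR_l2_def scaleC_scaleC)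
  show "1 *\<^sub>R f = f"
    by (simp add: scaleR_l2_def scaleC_1)
  show "r *\<^sub>R f = of_real r *\<^sub>C f"
    by (rule scaleR_l2_def)
  show "sgn f = inverse (norm f) *\<^sub>R f" "dist f g = norm (f - g)" "norm f = sqrt (inner f f)"
       "inner f g = Re (cinner f g)"
    by (rule sgn_l2_def dist_l2_def norm_l2_def inner_l2_def)+
  show "(uniformity :: ('a l2 \<times> 'a l2) filter) =
      (INF e\<in>{0<..}. principal {(x, y). dist x y < e})"
    by (rule uniformity_l2_def)
  show "open U \<longleftrightarrow> (\<forall>x\<in>U. eventually (\<lambda>(x', y). x' = x \<longrightarrow> y \<in> U) uniformity)"
    for U :: "'a l2 set"
    by (rule open_l2_def)
  show commute: "cinner f g = cnj (cinner g f)" for f g :: "'a l2"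
  proof transfer
    fix f g :: "'a \<Rightarrow> complex"
    show "(\<integral>x. f x * cnj (g x) \<partial>lborel) = cnj (\<integral>x. g x * cnj (f x) \<partial>lborel)"
      using Bochner_Integration.integral_cnj[of lborel "\<lambda>x. g x * cnj (f x)"]
      by (simp only: complex_cnj_mult complex_cnj_cnj mult.commute)
  qed
  show cinner_add: "cinner (f + g) h = cinner f h + cinner g h"
  proof transfer
    fix f g h :: "'a \<Rightarrow> complex"
    assume "l2_eq f f" "l2_eq g g" "l2_eq h h"
    then have "integrable lborel (\<lambda>x. f x * cnj (h x))" "integrable lborel (\<lambda>x. g x * cnj (h x))"
      by (auto simp: l2_eq_def sq_integrable_mult)
    then show "(\<integral>x. (f x + g x) * cnj (h x) \<partial>lborel) =
        (\<integral>x. f x * cnj (h x) \<partial>lborel) + (\<integral>x. g x * cnj (h x) \<partial>lborel)"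
      by (simp add: ring_distribs)
  qed
  show cinner_scale: "cinner (a *\<^sub>C f) g = a * cinner f g" for a
    by transfer (simp add: mult.assoc)
  show "inner f g = inner g f"
    using commute[of f g] by (simp add: inner_l2_def)
  show "inner (f + g) h = inner f h + inner g h"
    by (simp add: inner_l2_def cinner_add)
  show "inner (r *\<^sub>R f) g = r * inner f g"
    by (simp add: inner_l2_def scaleR_l2_def cinner_scale)
  have cinner_self: "cinner f f = of_real (\<integral>x. (cmod (rep_l2 f x))\<^sup>2 \<partial>lborel)"
    by (simp add: cinner_l2.rep_eq complex_norm_square[symmetric] del: of_real_power)
  show "0 \<le> inner f f"
    by (simp add: inner_l2_def cinner_self)
  have "inner f f = 0 \<longleftrightarrow> f = 0"
    unfolding inner_l2_def
  proof transfer
    fix f :: "'a \<Rightarrow> complex"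
    assume "l2_eq f f"
    then have f: "sq_integrable f"
      by (simp add: l2_eq_def)
    have "(\<integral>x. f x * cnj (f x) \<partial>lborel) = of_real (\<integral>x. (cmod (f x))\<^sup>2 \<partial>lborel)"
      by (simp add: complex_norm_square[symmetric] del: of_real_power)
    moreover have "(\<integral>x. (cmod (f x))\<^sup>2 \<partial>lborel) = 0 \<longleftrightarrow> (AE x in lborel. (cmod (f x))\<^sup>2 = 0)"
      using f by (intro integral_nonneg_eq_0_iff_AE) (auto simp: sq_integrable_def)
    ultimately show "Re (\<integral>x. f x * cnj (f x) \<partial>lborel) = 0 \<longleftrightarrow> l2_eq f (\<lambda>x. 0)"
      using f by (simp add: l2_eq_def sq_integrable_0)
  qed
  then show "inner f f = 0 \<longleftrightarrow> f = 0" .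
qed

end


section \<open>The space H10\<close>

text \<open>A member \<open>f\<close> of the Sobolev space is represented by the pair \<open>(f, \<nabla>f)\<close> of square integrable
  functions, extended by zero outside \<open>\<Omega>\<close>. The inner product \<^const>\<open>cinner\<close> of the product space
  is then \<open>\<integral> f cnj(g) + \<integral> \<nabla>f \<bullet> cnj(\<nabla>g)\<close>, and its topology is that of the Sobolev norm.
  On the closure \<open>H10\<close> below the second component is the weak gradient of the first one and hence
  determined by it.\<close>

type_synonym 'n sobolev = "(real ^ 'n) l2 \<times> (((real ^ 'n) l2) ^ 'n)"

definition with_gradient :: "(real ^ 'n \<Rightarrow> complex) \<Rightarrow> 'n::finite sobolev" where
  "with_gradient \<phi> = (l2_class \<phi>, \<chi> i. l2_class (\<lambda>x. frechet_derivative \<phi> (at x) (axis i 1)))"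

definition H10 :: "(real ^ 'n) set \<Rightarrow> 'n::finite sobolev set" where
  "H10 \<Omega> = closure (with_gradient ` test_functions \<Omega>)"

definition L2_inner :: "'n::finite sobolev \<Rightarrow> 'n sobolev \<Rightarrow> complex" where
  "L2_inner f g = cinner (fst f) (fst g)"

definition GG :: "(real ^ 'n) set \<Rightarrow> ('n::finite sobolev \<Rightarrow> 'n sobolev) set" where
  "GG \<Omega> = {G \<in> Gl (H10 \<Omega>). \<forall>f\<in>H10 \<Omega>. \<forall>g\<in>H10 \<Omega>. L2_inner (G f) (G g) = L2_inner f g}"

definition smeared :: "(real \<Rightarrow> 'a \<Rightarrow> 'a) \<Rightarrow> (real \<Rightarrow> complex) \<Rightarrow> 'a::complex_inner \<Rightarrow> 'a" where
  "smeared G \<phi> f = integral UNIV (\<lambda>t. \<phi> t *\<^sub>C G t f)"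

end

theory Submission
  imports Defs
begin

text \<open>
  Everything rests on the smeared vectors \<open>f\<^sub>\<phi> = \<integral> \<phi>(s) G(s)f ds\<close>. Moving a translation of the group into
  the weight gives \<open>G(t)f\<^sub>\<phi> = \<integral> \<phi>(s - t) G(s)f ds\<close>, again a smeared vector, and differentiating under
  the integral shows that the orbit of \<open>f\<^sub>\<phi>\<close> has derivative \<open>- f\<^sub>\<phi>\<^sub>'\<close> at \<open>0\<close>. So the span \<open>D\<close> is invariant under
  the group and under its derivative; approximate identities built from \<open>exp(-1/x)\<close> make it dense. The
  integrals exist because L2, and with it the Sobolev space, is complete (Riesz and Fischer).

  The square root \<open>R\<close> of \<open>A\<close> is bounded and intertwines the two groups, \<open>U(t)R = RG(t)\<close>, so it carries
  invariance and differentiability from \<open>D\<close> to \<open>R(D)\<close>. Density of \<open>R(D)\<close> needs density of the range of \<open>R\<close>: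
  a vector \<open>y\<close> orthogonal to this range has \<open>\<langle>Ay, y\<rangle> = 0\<close>, i.e. its L2 component vanishes, and then so does
  its gradient component, which by integration by parts is orthogonal to all test functions while being a
  limit of test functions (\<open>H10_eq_0_if_fst_eq_0\<close>).

  For the generator, let \<open>x \<in> R(D)\<close> and let \<open>\<mu>\<close> be the spectral measure of \<open>S\<close> at \<open>x\<close>. The difference
  quotients of \<open>U(t)x\<close> have squared norm \<open>\<integral> |(exp(\<i>tl) - 1)/t|\<^sup>2 d\<mu>(l)\<close>; they are bounded, so Fatou's lemma
  gives \<open>\<integral> l\<^sup>2 d\<mu> < \<infinity>\<close>, that is, \<open>x\<close> is in the domain of \<open>S\<close>. Dominated convergence then identifies the
  quadratic form of the derivative with that of \<open>\<i>S\<close>, and polarization on the dense space \<open>R(D)\<close> identifies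
  the operators (\<open>generator_on_dense_subspace\<close>). Differentiating \<open>U(t)Rf = RG(t)f\<close> yields
  \<open>\<i>SRf = R(d/dt G(t)f)\<close> and hence invariance of \<open>R(D)\<close> under \<open>S\<close>.

  Finally \<open>R(D)\<close> is a core (\<open>differentiable_invariant_subspace_is_core\<close>). The graph of \<open>S\<close> is closed, so by
  projection in the product space it suffices that a vector \<open>(y, Sy)\<close> orthogonal to the graph over
  \<open>R(D)\<close> is \<open>0\<close>. For \<open>x \<in> R(D)\<close> the bounded function \<open>g(t) = \<langle>U(t)x, y\<rangle>\<close> then satisfies \<open>g'' = g\<close>, so
  \<open>g = 0\<close>, and \<open>y\<close> is orthogonal to a dense subspace.
\<close>

section \<open>Complex inner product spaces\<close>

lemma cinner_add_right: "cinner x (y + z) = cinner x y + cinner x z"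
  by (metis cinner_commute cinner_add_left complex_cnj_add)

lemma cinner_scaleC_right: "cinner x (a *\<^sub>C y) = cnj a * cinner x y"
  by (metis cinner_commute cinner_scaleC_left complex_cnj_mult)

lemma scaleC_one [simp]: "1 *\<^sub>C x = x"
  using scaleR_eq_scaleC[of 1 x] by simp

lemma scaleC_zero_left [simp]: "0 *\<^sub>C x = 0"
  using scaleR_eq_scaleC[of 0 x] by simp

lemma scaleC_minus_one: "(-1) *\<^sub>C x = - x"
  using scaleR_eq_scaleC[of "-1" x] by simp

lemma cinner_scaleR_left: "cinner (r *\<^sub>R x) y = r *\<^sub>R cinner x y"
  by (simp add: scaleR_eq_scaleC cinner_scaleC_left scaleR_conv_of_real)

lemma cinner_scaleR_right: "cinner x (r *\<^sub>R y) = r *\<^sub>R cinner x y"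
  by (simp add: scaleR_eq_scaleC cinner_scaleC_right scaleR_conv_of_real)

lemma cinner_self: "cinner x x = of_real ((norm x)\<^sup>2)"
proof (rule complex_eqI)
  show "Re (cinner x x) = Re (of_real ((norm x)\<^sup>2))"
    by (simp add: power2_norm_eq_inner inner_eq_Re_cinner)
  have "Im (cinner x x) = - Im (cinner x x)"
    by (subst cinner_commute) simp
  then show "Im (cinner x x) = Im (of_real ((norm x)\<^sup>2))"
    by simp
qed

lemma norm_scaleC: "norm (a *\<^sub>C x) = cmod a * norm x"
proof -
  have "of_real ((norm (a *\<^sub>C x))\<^sup>2) = a * cnj a * cinner x x"
    by (simp add: cinner_self[symmetric] cinner_scaleC_left cinner_scaleC_right del: of_real_power)
  also have "\<dots> = of_real ((cmod a * norm x)\<^sup>2)"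
    by (simp only: cinner_self complex_norm_square[symmetric] power_mult_distrib of_real_mult)
  finally have "(norm (a *\<^sub>C x))\<^sup>2 = (cmod a * norm x)\<^sup>2"
    unfolding of_real_eq_iff .
  then show ?thesis
    by simp
qed

text \<open>Multiplying by the phase \<open>a\<close> that makes \<^term>\<open>cinner x y\<close> real and nonnegative reduces the
  inequality to its real version.\<close>

lemma Cauchy_Schwarz_cinner: "cmod (cinner x y) \<le> norm x * norm y"
proof (cases "cinner x y = 0")
  case False
  define a where "a = cnj (cinner x y) / cmod (cinner x y)"
  have a: "cmod a = 1"
    using False by (simp add: a_def norm_divide)
  have "cinner (a *\<^sub>C x) y = cmod (cinner x y)"
    using False complex_norm_square[of "cinner x y"]
    by (simp add: cinner_scaleC_left a_def power2_eq_square divide_eq_eq mult.commute)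
  then have "cmod (cinner x y) = inner (a *\<^sub>C x) y"
    by (simp add: inner_eq_Re_cinner)
  also have "\<dots> \<le> norm (a *\<^sub>C x) * norm y"
    by (rule norm_cauchy_schwarz)
  finally show ?thesis
    by (simp add: norm_scaleC a)
qed simp

lemma bounded_bilinear_cinner:
  "bounded_bilinear (cinner :: 'a::complex_inner \<Rightarrow> 'a \<Rightarrow> complex)"
proof
  show "\<exists>K. \<forall>a b :: 'a. cmod (cinner a b) \<le> norm a * norm b * K"
    by (rule exI[of _ 1]) (simp add: Cauchy_Schwarz_cinner)
qed (auto simp: cinner_add_left cinner_add_right cinner_scaleR_left cinner_scaleR_right)

lemma bounded_bilinear_scaleC:
  "bounded_bilinear (scaleC :: complex \<Rightarrow> 'a::complex_inner \<Rightarrow> 'a)"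
proof
  show "\<exists>K. \<forall>a (b :: 'a). norm (a *\<^sub>C b) \<le> norm a * norm b * K"
    by (rule exI[of _ 1]) (simp add: norm_scaleC)
qed (auto simp: scaleC_add_left scaleC_add_right scaleR_eq_scaleC scaleC_scaleC
      scaleR_conv_of_real mult.commute)

lemmas tendsto_cinner [tendsto_intros] = bounded_bilinear.tendsto[OF bounded_bilinear_cinner]
lemmas continuous_on_cinner [continuous_intros] =
  bounded_bilinear.continuous_on[OF bounded_bilinear_cinner]
lemmas continuous_on_scaleC [continuous_intros] =
  bounded_bilinear.continuous_on[OF bounded_bilinear_scaleC]
lemmas has_vector_derivative_scaleC =
  bounded_bilinear.has_vector_derivative[OF bounded_bilinear_scaleC]

lemmas cinner_zero_left [simp] = bounded_bilinear.zero_left[OF bounded_bilinear_cinner]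
lemmas cinner_diff_left = bounded_bilinear.diff_left[OF bounded_bilinear_cinner]
lemmas cinner_minus_left = bounded_bilinear.minus_left[OF bounded_bilinear_cinner]
lemmas scaleC_zero_right [simp] = bounded_bilinear.zero_right[OF bounded_bilinear_scaleC]
lemmas scaleC_diff_right = bounded_bilinear.diff_right[OF bounded_bilinear_scaleC]

lemma cinner_eq_0_commute: "cinner x y = 0 \<longleftrightarrow> cinner y x = 0"
  by (metis cinner_commute complex_cnj_zero)

lemma cinner_self_eq_0 [simp]: "cinner x x = 0 \<longleftrightarrow> x = 0"
  by (simp add: cinner_self)

lemma csubspace_imp_subspace: "csubspace V \<Longrightarrow> subspace V"
  by (auto simp: csubspace_def subspace_def scaleR_eq_scaleC)

lemma csubspace_0: "csubspace V \<Longrightarrow> 0 \<in> V"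
  and csubspace_add: "csubspace V \<Longrightarrow> x \<in> V \<Longrightarrow> y \<in> V \<Longrightarrow> x + y \<in> V"
  and csubspace_scaleC: "csubspace V \<Longrightarrow> x \<in> V \<Longrightarrow> a *\<^sub>C x \<in> V"
  by (auto simp: csubspace_def)

lemma csubspace_diff: "csubspace V \<Longrightarrow> x \<in> V \<Longrightarrow> y \<in> V \<Longrightarrow> x - y \<in> V"
  by (simp add: csubspace_imp_subspace subspace_diff)

lemma csubspace_minus: "csubspace V \<Longrightarrow> x \<in> V \<Longrightarrow> - x \<in> V"
  by (simp add: csubspace_imp_subspace subspace_neg)

lemma csubspace_closure:
  assumes "csubspace V"
  shows "csubspace (closure V)"
  unfolding csubspace_def
proof (intro conjI ballI allI)
  show "0 \<in> closure V"
    using assms closure_subset by (auto simp: csubspace_def)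
  show "x + y \<in> closure V" if x: "x \<in> closure V" and y: "y \<in> closure V" for x y
  proof -
    obtain f where "\<And>n. f n \<in> V" "f \<longlonglongrightarrow> x"
      using x unfolding closure_sequential by blast
    moreover obtain g where "\<And>n. g n \<in> V" "g \<longlonglongrightarrow> y"
      using y unfolding closure_sequential by blast
    ultimately show ?thesis
      unfolding closure_sequential
      by (intro exI[of _ "\<lambda>n. f n + g n"]) (auto intro: tendsto_add csubspace_add[OF assms])
  qed
  show "a *\<^sub>C x \<in> closure V" if "x \<in> closure V" for a x
  proof -
    have "(*\<^sub>C) a ` closure V \<subseteq> closure V"
      using csubspace_scaleC[OF assms] closure_subset[of V]
      by (intro image_closure_subset continuous_intros) auto
    then show ?thesis
      using that by blast
  qed
qed

section \<open>Orthogonal projection\<close>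

text \<open>A minimizing sequence for the distance from \<open>z\<close> is Cauchy by the parallelogram law.\<close>

lemma nearest_point_exists:
  fixes V :: "'a::{real_inner, complete_space} set"
  assumes V: "subspace V" "closed V"
  obtains m where "m \<in> V" "\<And>x. x \<in> V \<Longrightarrow> norm (z - m) \<le> norm (z - x)"
proof -
  have ne: "V \<noteq> {}"
    using V subspace_0 by auto
  define d where "d = infdist z V"
  have d_le: "d \<le> norm (z - x)" if "x \<in> V" for x
    using infdist_le[OF that, of z] by (simp add: d_def dist_norm)
  have d0: "0 \<le> d"
    by (simp add: d_def infdist_nonneg)
  have "\<exists>x\<in>V. norm (z - x) < d + 1 / Suc n" for n
  proof -
    have "\<exists>x\<in>V. dist z x < d + 1 / Suc n"
      using ne unfolding d_def infdist_notempty[OF ne]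
      by (subst cINF_less_iff[symmetric]) auto
    then show ?thesis
      by (simp add: dist_norm)
  qed
  then obtain X where X: "\<And>n. X n \<in> V" "\<And>n. norm (z - X n) < d + 1 / Suc n"
    by metis
  have par: "(norm (X m - X n))\<^sup>2 \<le> 2 * (norm (z - X m))\<^sup>2 + 2 * (norm (z - X n))\<^sup>2 - 4 * d\<^sup>2"
    for m n
  proof -
    \<comment> \<open>The midpoint competes for the distance, which bounds the sum term of the parallelogram law
      from below.\<close>
    have "(1/2) *\<^sub>R (X m + X n) \<in> V"
      using X V by (intro subspace_scale subspace_add)
    then have "d \<le> norm (z - (1/2) *\<^sub>R (X m + X n))"
      by (rule d_le)
    also have "\<dots> = norm ((1/2) *\<^sub>R ((z - X m) + (z - X n)))"
      by (simp add: algebra_simps flip: scaleR_2)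
    finally have "2 * d \<le> norm ((z - X m) + (z - X n))"
      by simp
    then have "4 * d\<^sup>2 \<le> (norm ((z - X m) + (z - X n)))\<^sup>2"
      using power_mono[of "2 * d" _ 2] d0 by (simp add: power_mult_distrib)
    moreover have "norm (X m - X n) = norm ((z - X m) - (z - X n))"
      by (simp add: norm_minus_commute)
    ultimately show ?thesis
      by (simp add: power2_norm_eq_inner inner_add_left inner_add_right inner_diff_left
          inner_diff_right inner_commute)
  qed
  have lim: "(\<lambda>n. norm (z - X n)) \<longlonglongrightarrow> d"
  proof (rule tendsto_sandwich)
    show "\<forall>\<^sub>F n in sequentially. norm (z - X n) \<le> d + 1 / real (Suc n)"
      using X(2) by (intro always_eventually allI less_imp_le)
    show "\<forall>\<^sub>F n in sequentially. d \<le> norm (z - X n)"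
      using X(1) by (intro always_eventually allI d_le)
    show "(\<lambda>n. d + 1 / real (Suc n)) \<longlonglongrightarrow> d"
      using LIMSEQ_inverse_real_of_nat_add[of d] by (simp add: inverse_eq_divide)
    show "(\<lambda>n. d) \<longlonglongrightarrow> d"
      by simp
  qed
  have "Cauchy X"
    unfolding Cauchy_altdef
  proof (intro allI impI)
    fix e :: real assume e: "0 < e"
    have "(\<lambda>n. (norm (z - X n))\<^sup>2) \<longlonglongrightarrow> d\<^sup>2"
      by (intro tendsto_intros lim)
    then have "\<forall>\<^sub>F n in sequentially. (norm (z - X n))\<^sup>2 < d\<^sup>2 + e\<^sup>2 / 4"
      using e by (intro order_tendstoD) auto
    then obtain N where N: "\<And>n. n \<ge> N \<Longrightarrow> (norm (z - X n))\<^sup>2 < d\<^sup>2 + e\<^sup>2 / 4"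
      by (auto simp: eventually_sequentially)
    have "dist (X m) (X n) < e" if "m \<ge> N" "n > m" for m n
    proof -
      have "(norm (X m - X n))\<^sup>2 < e\<^sup>2"
        using par[of m n] N[of m] N[of n] that by simp
      then show ?thesis
        using e by (simp add: dist_norm power2_less_imp_less)
    qed
    then show "\<exists>M. \<forall>m\<ge>M. \<forall>n>m. dist (X m) (X n) < e"
      by blast
  qed
  then obtain m where m: "X \<longlonglongrightarrow> m"
    by (auto simp: Cauchy_convergent_iff convergent_def)
  have "norm (z - m) = d"
    by (rule LIMSEQ_unique[OF _ lim]) (intro tendsto_intros m)
  with that[of m] closed_sequentially[OF V(2) X(1) m] d_le show ?thesis
    by auto
qed

text \<open>Minimality of the distance along a line \<open>m + t x\<close>, with the optimal \<open>t\<close>, gives orthogonality for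
  the real inner product; applied to \<open>\<i> x\<close> as well, it gives the imaginary part.\<close>

lemma orthogonal_decomposition:
  fixes V :: "'a::{complex_inner, complete_space} set"
  assumes V: "csubspace V" "closed V"
  obtains m where "m \<in> V" "\<And>x. x \<in> V \<Longrightarrow> cinner x (z - m) = 0"
proof -
  obtain m where m: "m \<in> V" "\<And>x. x \<in> V \<Longrightarrow> norm (z - m) \<le> norm (z - x)"
    using nearest_point_exists[OF csubspace_imp_subspace[OF V(1)] V(2)] by blast
  have re: "inner x (z - m) = 0" if x: "x \<in> V" for x
  proof (rule ccontr)
    define c where "c = inner x (z - m)"
    assume "inner x (z - m) \<noteq> 0"
    then have c: "c \<noteq> 0" and n: "norm x > 0"
      by (auto simp: c_def)
    define t where "t = c / (norm x)\<^sup>2"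
    have "m + t *\<^sub>R x \<in> V"
      using csubspace_imp_subspace[OF V(1)] m x by (intro subspace_add subspace_scale)
    then have "norm (z - m) \<le> norm ((z - m) - t *\<^sub>R x)"
      using m(2) by (simp add: diff_diff_eq)
    then have "(norm (z - m))\<^sup>2 \<le> (norm ((z - m) - t *\<^sub>R x))\<^sup>2"
      by simp
    also have "\<dots> = (norm (z - m))\<^sup>2 - 2 * t * c + t\<^sup>2 * (norm x)\<^sup>2"
      by (simp only: power2_norm_eq_inner inner_diff_left inner_diff_right c_def)
        (simp add: inner_commute power2_eq_square algebra_simps)
    also have "\<dots> = (norm (z - m))\<^sup>2 - c\<^sup>2 / (norm x)\<^sup>2"
      using n by (simp add: t_def power2_eq_square field_simps)
    finally have "c\<^sup>2 / (norm x)\<^sup>2 \<le> 0"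
      by simp
    then show False
      using c n by (simp add: divide_le_0_iff)
  qed
  have "cinner x (z - m) = 0" if x: "x \<in> V" for x
  proof (rule complex_eqI)
    show "Re (cinner x (z - m)) = Re 0"
      using re[OF x] by (simp add: inner_eq_Re_cinner)
    show "Im (cinner x (z - m)) = Im 0"
      using re[OF csubspace_scaleC[OF V(1) x, of \<i>]]
      by (simp add: inner_eq_Re_cinner cinner_scaleC_left)
  qed
  with m that show ?thesis
    by blast
qed

text \<open>Subtracting from \<open>z \<in> W\<close> its projection onto the closure of \<open>V\<close> leaves a vector of \<open>W\<close>
  orthogonal to \<open>V\<close>. With \<open>V\<close> the range of an operator this criterion gives a dense range; in the
  product space, with \<open>V\<close> and \<open>W\<close> graphs, it gives a core.\<close>

lemma closureI_orthogonal:
  fixes V W :: "'a::{complex_inner, complete_space} set"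
  assumes V: "csubspace V" and W: "csubspace W" "closed W" "V \<subseteq> W"
    and orth: "\<And>y. y \<in> W \<Longrightarrow> (\<And>x. x \<in> V \<Longrightarrow> cinner x y = 0) \<Longrightarrow> y = 0"
  shows "W \<subseteq> closure V"
proof
  fix z assume z: "z \<in> W"
  obtain m where m: "m \<in> closure V" "\<And>x. x \<in> closure V \<Longrightarrow> cinner x (z - m) = 0"
    using orthogonal_decomposition[OF csubspace_closure[OF V] closed_closure] by blast
  have "z - m = 0"
  proof (rule orth)
    show "z - m \<in> W"
      using z m(1) W closure_minimal[OF W(3,2)] by (intro csubspace_diff) auto
  qed (use m(2) closure_subset in auto)
  with m show "z \<in> closure V"
    by simp
qed

lemma dense_orthogonal_imp_0:
  assumes "dense_in H V" "y \<in> H" "\<And>x. x \<in> V \<Longrightarrow> cinner x y = 0"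
  shows "y = 0"
proof -
  have "closed {x. cinner x y = 0}"
    by (intro closed_Collect_eq continuous_intros)
  then have "closure V \<subseteq> {x. cinner x y = 0}"
    using assms by (intro closure_minimal) auto
  then have "cinner y y = 0"
    using assms(1,2) by (auto simp: dense_in_def)
  then show ?thesis
    by simp
qed

section \<open>Bounded operators on a subspace\<close>

lemma clinear_from_toD:
  assumes "clinear_from_to V H T"
  shows "csubspace V" "x \<in> V \<Longrightarrow> T x \<in> H" "x \<in> V \<Longrightarrow> y \<in> V \<Longrightarrow> T (x + y) = T x + T y"
    "x \<in> V \<Longrightarrow> T (a *\<^sub>C x) = a *\<^sub>C T x" "x \<in> V \<Longrightarrow> T (r *\<^sub>R x) = r *\<^sub>R T x"
    "T 0 = 0"
    "x \<in> V \<Longrightarrow> y \<in> V \<Longrightarrow> T (x - y) = T x - T y"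
proof -
  show V: "csubspace V" and add: "x \<in> V \<Longrightarrow> y \<in> V \<Longrightarrow> T (x + y) = T x + T y"
    and sc: "x \<in> V \<Longrightarrow> T (a *\<^sub>C x) = a *\<^sub>C T x" and "x \<in> V \<Longrightarrow> T x \<in> H" for x y a
    using assms by (auto simp: clinear_from_to_def)
  show "x \<in> V \<Longrightarrow> T (r *\<^sub>R x) = r *\<^sub>R T x"
    by (simp add: scaleR_eq_scaleC sc)
  show "T 0 = 0"
    using sc[OF csubspace_0[OF V], of 0] by simp
  show "T (x - y) = T x - T y" if "x \<in> V" "y \<in> V"
    using add[of x "(-1) *\<^sub>C y"] sc[of y "-1"] csubspace_scaleC[OF V, of y "-1"] that
    by (simp add: scaleC_minus_one)
qed

lemma clinear_image_csubspace:
  assumes "clinear_from_to V H T" "csubspace W" "W \<subseteq> V"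
  shows "csubspace (T ` W)"
proof -
  have "T x + T y \<in> T ` W" if "x \<in> W" "y \<in> W" for x y
    using that assms clinear_from_toD(3)[OF assms(1)] csubspace_add[OF assms(2)]
    by (metis image_eqI subsetD)
  moreover have "a *\<^sub>C T x \<in> T ` W" if "x \<in> W" for x a
    using that assms clinear_from_toD(4)[OF assms(1)] csubspace_scaleC[OF assms(2)]
    by (metis image_eqI subsetD)
  moreover have "0 \<in> T ` W"
    using clinear_from_toD(6)[OF assms(1)] csubspace_0[OF assms(2)] by (metis image_eqI)
  ultimately show ?thesis
    by (auto simp: csubspace_def)
qed

lemma bounded_opE:
  assumes "bounded_op H T"
  obtains K where "K > 0" "\<And>x. x \<in> H \<Longrightarrow> norm (T x) \<le> K * norm x"
proof -
  obtain K where K: "\<And>x. x \<in> H \<Longrightarrow> norm (T x) \<le> K * norm x"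
    using assms by (auto simp: bounded_op_def)
  have "norm (T x) \<le> max K 1 * norm x" if "x \<in> H" for x
    using K[OF that] by (rule order_trans) (simp add: mult_right_mono)
  then show ?thesis
    by (intro that[of "max K 1"]) auto
qed

lemma bounded_op_clinear: "bounded_op H T \<Longrightarrow> clinear_from_to H H T"
  by (simp add: bounded_op_def)

lemma continuous_on_bounded_op:
  assumes T: "bounded_op H T"
  shows "continuous_on H T"
proof -
  obtain K where K: "K > 0" "\<And>x. x \<in> H \<Longrightarrow> norm (T x) \<le> K * norm x"
    using bounded_opE[OF T] by blast
  note lin = clinear_from_toD[OF bounded_op_clinear[OF T]]
  have "dist (T x) (T y) \<le> K * dist x y" if "x \<in> H" "y \<in> H" for x y
    using K(2)[OF csubspace_diff[OF lin(1) that]] that by (simp add: dist_norm lin)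
  then have "K-lipschitz_on H T"
    using K(1) by (intro lipschitz_onI) auto
  then show ?thesis
    by (rule lipschitz_on_continuous_on)
qed

lemma bounded_op_dense_image:
  assumes T: "bounded_op H T" and V: "dense_in H V" and TH: "dense_in H (T ` H)"
  shows "dense_in H (T ` V)"
  unfolding dense_in_def
proof
  show "T ` V \<subseteq> H"
    using V TH by (auto simp: dense_in_def)
  have "T ` H \<subseteq> closure (T ` V)"
  proof
    fix y assume "y \<in> T ` H"
    then obtain x where x: "x \<in> H" "y = T x"
      by auto
    have "x \<in> closure V"
      using x V by (auto simp: dense_in_def)
    then obtain s where s: "\<And>n. s n \<in> V" "s \<longlonglongrightarrow> x"
      unfolding closure_sequential by blast
    have "(\<lambda>n. T (s n)) \<longlonglongrightarrow> T x"
      using V x s(1)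
      by (intro continuous_on_tendsto_compose[OF continuous_on_bounded_op[OF T] s(2)])
        (auto simp: dense_in_def intro!: always_eventually)
    then show "y \<in> closure (T ` V)"
      unfolding closure_sequential x by (intro exI[of _ "\<lambda>n. T (s n)"]) (use s in \<open>auto\<close>)
  qed
  then have "closure (T ` H) \<subseteq> closure (T ` V)"
    by (intro closure_minimal) auto
  then show "H \<subseteq> closure (T ` V)"
    using TH by (auto simp: dense_in_def)
qed

lemma has_vector_derivative_iff_quotient:
  fixes f :: "real \<Rightarrow> 'a::real_normed_vector"
  shows "(f has_vector_derivative f') (at t) \<longleftrightarrow>
    ((\<lambda>h. (1 / h) *\<^sub>R (f (t + h) - f t)) \<longlongrightarrow> f') (at 0)"
proof -
  have "norm (f (t + h) - f t - h *\<^sub>R f') / norm h = norm ((1 / h) *\<^sub>R (f (t + h) - f t) - f')"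
    if "h \<noteq> 0" for h
  proof -
    have "(1 / h) *\<^sub>R (f (t + h) - f t) - f' = (1 / h) *\<^sub>R (f (t + h) - f t - h *\<^sub>R f')"
      using that by (simp add: scaleR_diff_right)
    then show ?thesis
      by (simp add: divide_inverse abs_inverse mult.commute)
  qed
  then have "((\<lambda>h. norm (f (t + h) - f t - h *\<^sub>R f') / norm h) \<longlongrightarrow> 0) (at 0) \<longleftrightarrow>
      ((\<lambda>h. norm ((1 / h) *\<^sub>R (f (t + h) - f t) - f')) \<longlongrightarrow> 0) (at 0)"
    by (intro filterlim_cong refl) (auto simp: eventually_at_filter)
  then show ?thesis
    unfolding has_vector_derivative_def has_derivative_at
    by (simp only: bounded_linear_scaleR_left tendsto_norm_zero_iff LIM_zero_iff simp_thms)
qed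

text \<open>The difference quotients of \<open>f\<close> lie in \<open>H\<close>, where \<open>T\<close> is linear and continuous; outside
  \<open>H\<close> the function \<open>T\<close> is arbitrary, so the chain rule for bounded linear maps does not apply.\<close>

lemma bounded_op_has_vector_derivative:
  assumes T: "bounded_op H T" and f: "\<And>s. f s \<in> H" "f' \<in> H"
    and deriv: "(f has_vector_derivative f') (at t)"
  shows "((\<lambda>s. T (f s)) has_vector_derivative T f') (at t)"
proof -
  note lin = clinear_from_toD[OF bounded_op_clinear[OF T]]
  have q: "(1 / h) *\<^sub>R (f (t + h) - f t) \<in> H" for h
    using f lin(1) by (intro subspace_scale[OF csubspace_imp_subspace] csubspace_diff)
  have "((\<lambda>h. (1 / h) *\<^sub>R (f (t + h) - f t)) \<longlongrightarrow> f') (at 0)"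
    using deriv by (simp add: has_vector_derivative_iff_quotient)
  then have "((\<lambda>h. T ((1 / h) *\<^sub>R (f (t + h) - f t))) \<longlongrightarrow> T f') (at 0)"
    using f q by (intro continuous_on_tendsto_compose[OF continuous_on_bounded_op[OF T]]) auto
  then show ?thesis
    using f lin(1,5,7) by (simp add: has_vector_derivative_iff_quotient csubspace_diff)
qed

text \<open>Polarization: the values of the quadratic form at \<open>x + y\<close> and \<open>x + \<i>y\<close> give the sum and the
  difference of \<open>\<langle>Tx, y\<rangle>\<close> and \<open>\<langle>Ty, x\<rangle>\<close>.\<close>

lemma quadratic_form_eq_imp_form_eq:
  assumes "clinear_from_to V UNIV T" "clinear_from_to V UNIV R"
    and q: "\<And>x. x \<in> V \<Longrightarrow> cinner (T x) x = cinner (R x) x"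
    and xy: "x \<in> V" "y \<in> V"
  shows "cinner (T x) y = cinner (R x) y"
proof -
  note lT = clinear_from_toD[OF assms(1)] and lR = clinear_from_toD[OF assms(2)]
  have 1: "cinner (T x) y + cinner (T y) x = cinner (R x) y + cinner (R y) x"
    using q[OF csubspace_add[OF lT(1) xy]] q xy
    by (simp add: lT lR cinner_add_left cinner_add_right add.commute)
  have "\<i> * (- cinner (T x) y + cinner (T y) x) = \<i> * (- cinner (R x) y + cinner (R y) x)"
    using q[OF csubspace_add[OF lT(1) xy(1) csubspace_scaleC[OF lT(1) xy(2)]], of \<i>] q xy
    by (simp add: lT lR csubspace_scaleC[OF lT(1)] cinner_add_left cinner_add_right
        cinner_scaleC_left cinner_scaleC_right algebra_simps)
  then have 2: "- cinner (T x) y + cinner (T y) x = - cinner (R x) y + cinner (R y) x"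
    by simp
  have "2 * cinner (T x) y = 2 * cinner (R x) y"
    using arg_cong2[OF 1 2, of minus] by simp
  then show ?thesis
    by simp
qed

section \<open>Completeness of the space L2\<close>

lemma norm_l2_class:
  assumes "sq_integrable f"
  shows "(norm (l2_class f))\<^sup>2 = (\<integral>x. (cmod (f x))\<^sup>2 \<partial>lborel)"
proof -
  have "of_real ((norm (l2_class f))\<^sup>2) = cinner (l2_class f) (l2_class f)"
    by (simp add: cinner_self)
  also have "\<dots> = (\<integral>x. f x * cnj (f x) \<partial>lborel)"
    using assms by (simp add: cinner_l2.abs_eq l2_eq_def)
  also have "\<dots> = of_real (\<integral>x. (cmod (f x))\<^sup>2 \<partial>lborel)"
    by (simp add: complex_norm_square[symmetric] del: of_real_power)
  finally show ?thesis
    unfolding of_real_eq_iff .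
qed

lemma sq_integrable_rep_l2: "sq_integrable (rep_l2 f)"
  using Quotient_l2 Quotient_rep_reflp[of l2_eq l2_class rep_l2] by (simp add: l2_eq_def)

lemma l2_class_rep: "l2_class (rep_l2 f) = f"
  using Quotient_l2 by (rule Quotient_abs_rep)

lemma sq_integrable_diff: "sq_integrable f \<Longrightarrow> sq_integrable g \<Longrightarrow> sq_integrable (\<lambda>x. f x - g x)"
  using sq_integrable_add[of f "\<lambda>x. -1 * g x"] sq_integrable_cmult[of g "-1"] by simp

lemma l2_class_add:
  "sq_integrable f \<Longrightarrow> sq_integrable g \<Longrightarrow> l2_class f + l2_class g = l2_class (\<lambda>x. f x + g x)"
  by (rule plus_l2.abs_eq) (auto simp: l2_eq_def)

lemma l2_class_diff:
  assumes "sq_integrable f" "sq_integrable g"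
  shows "l2_class f - l2_class g = l2_class (\<lambda>x. f x - g x)"
  using l2_class_add[OF sq_integrable_diff[OF assms] assms(2)] by (simp add: diff_eq_eq)

lemma norm_l2_diff:
  "(norm (f - g))\<^sup>2 = (\<integral>x. (cmod (rep_l2 f x - rep_l2 g x))\<^sup>2 \<partial>lborel)"
  using norm_l2_class[OF sq_integrable_diff[OF sq_integrable_rep_l2 sq_integrable_rep_l2, of f g]]
    l2_class_diff[OF sq_integrable_rep_l2 sq_integrable_rep_l2, of f g]
  by (simp add: l2_class_rep)

lemma nn_integral_l2_diff:
  "(\<integral>\<^sup>+x. ennreal ((cmod (rep_l2 f x - rep_l2 g x))\<^sup>2) \<partial>lborel) = ennreal ((norm (f - g))\<^sup>2)"
  using sq_integrable_diff[OF sq_integrable_rep_l2 sq_integrable_rep_l2, of f g]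
  by (subst nn_integral_eq_integral) (auto simp: sq_integrable_def norm_l2_diff)

text \<open>With \<open>\<parallel>X\<^sub>n\<^sub>+\<^sub>1 - X\<^sub>n\<parallel> \<le> 2\<^sup>-\<^sup>n\<close> the weighted sum \<open>\<Sum> 2\<^sup>n |X\<^sub>n\<^sub>+\<^sub>1 - X\<^sub>n|\<^sup>2\<close> has finite integral, so
  almost everywhere its terms are bounded and the increments decay geometrically.\<close>

lemma l2_fast_Cauchy_imp_AE_convergent:
  fixes X :: "nat \<Rightarrow> 'a::euclidean_space l2"
  assumes X: "\<And>n. norm (X (Suc n) - X n) \<le> (1/2) ^ n"
  shows "AE x in lborel. convergent (\<lambda>n. rep_l2 (X n) x)"
proof -
  define d where "d n x = rep_l2 (X (Suc n)) x - rep_l2 (X n) x" for n x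
  have meas [measurable]: "d n \<in> borel_measurable borel" for n
    using sq_integrable_diff[OF sq_integrable_rep_l2 sq_integrable_rep_l2, of "X (Suc n)" "X n"]
    by (simp add: sq_integrable_def d_def[abs_def])
  have "(\<integral>\<^sup>+x. (\<Sum>n. ennreal (2 ^ n * (cmod (d n x))\<^sup>2)) \<partial>lborel)
      = (\<Sum>n. \<integral>\<^sup>+x. ennreal (2 ^ n * (cmod (d n x))\<^sup>2) \<partial>lborel)"
    by (rule nn_integral_suminf) measurable
  also have "\<dots> = (\<Sum>n. ennreal (2 ^ n * (norm (X (Suc n) - X n))\<^sup>2))"
    by (simp add: ennreal_mult nn_integral_cmult) (simp add: d_def nn_integral_l2_diff)
  also have "\<dots> \<le> (\<Sum>n. ennreal ((1/2) ^ n))"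
  proof (intro suminf_le ennreal_leI)
    fix n
    have "(norm (X (Suc n) - X n))\<^sup>2 \<le> ((1/2) ^ n)\<^sup>2"
      using X by (intro power_mono) auto
    then have "2 ^ n * (norm (X (Suc n) - X n))\<^sup>2 \<le> 2 ^ n * ((1/2) ^ n)\<^sup>2"
      by (intro mult_left_mono) auto
    also have "\<dots> = (1/2 :: real) ^ n"
      by (simp add: power2_eq_square power_divide)
    finally show "2 ^ n * (norm (X (Suc n) - X n))\<^sup>2 \<le> (1/2) ^ n" .
  qed auto
  also have "\<dots> < \<infinity>"
    by (subst suminf_ennreal2) (auto simp: less_top[symmetric])
  finally have "AE x in lborel. (\<Sum>n. ennreal (2 ^ n * (cmod (d n x))\<^sup>2)) \<noteq> \<infinity>"
    by (intro nn_integral_PInf_AE) (auto simp: less_top)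
  then show ?thesis
  proof eventually_elim
    fix x assume "(\<Sum>n. ennreal (2 ^ n * (cmod (d n x))\<^sup>2)) \<noteq> \<infinity>"
    then have "summable (\<lambda>n. 2 ^ n * (cmod (d n x))\<^sup>2)"
      by (intro summable_suminf_not_top) auto
    then have "Bseq (\<lambda>n. 2 ^ n * (cmod (d n x))\<^sup>2)"
      using summable_LIMSEQ_zero convergent_imp_Bseq convergent_def by blast
    then obtain C where C: "\<And>n. 2 ^ n * (cmod (d n x))\<^sup>2 \<le> C"
      by (auto simp: Bseq_def)
    have "norm (d n x) \<le> sqrt C * (sqrt (1/2)) ^ n" for n
    proof -
      have "(cmod (d n x))\<^sup>2 \<le> C * (1/2) ^ n"
        using C[of n] by (simp add: field_simps power_divide)
      then have "norm (d n x) \<le> sqrt (C * (1/2) ^ n)"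
        by (rule real_le_rsqrt)
      then show ?thesis
        by (simp add: real_sqrt_mult real_sqrt_power)
    qed
    moreover have "summable (\<lambda>n. sqrt C * (sqrt (1/2)) ^ n)"
      by (rule summable_mult, rule summable_geometric) (simp add: real_sqrt_divide)
    ultimately have "summable (\<lambda>n. d n x)"
      by (rule summable_comparison_test'[rotated])
    then have "convergent (\<lambda>n. (\<Sum>i<n. d i x) + rep_l2 (X 0) x)"
      by (intro convergent_add) (auto simp: summable_iff_convergent convergent_const)
    moreover have "(\<Sum>i<n. d i x) + rep_l2 (X 0) x = rep_l2 (X n) x" for n
      by (simp add: d_def sum_lessThan_telescope[where f = "\<lambda>i. rep_l2 (X i) x"])
    ultimately show "convergent (\<lambda>n. rep_l2 (X n) x)"
      by simp
  qed
qed

text \<open>Fatou's lemma turns pointwise convergence into convergence in norm.\<close>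

lemma l2_fast_Cauchy_imp_convergent:
  fixes X :: "nat \<Rightarrow> 'a::euclidean_space l2"
  assumes X: "\<And>n. norm (X (Suc n) - X n) \<le> (1/2) ^ n" and C: "Cauchy X"
  shows "convergent X"
proof -
  define f where "f x = lim (\<lambda>n. rep_l2 (X n) x)" for x
  have m [measurable]: "rep_l2 (X n) \<in> borel_measurable borel" for n
    using sq_integrable_rep_l2[of "X n"] by (simp add: sq_integrable_def)
  have fm [measurable]: "f \<in> borel_measurable borel"
    unfolding f_def[abs_def] by measurable
  have lim: "AE x in lborel. (\<lambda>n. rep_l2 (X n) x) \<longlonglongrightarrow> f x"
    using l2_fast_Cauchy_imp_AE_convergent[OF X]
    by (simp add: f_def convergent_LIMSEQ_iff)
  have bound: "(\<integral>\<^sup>+x. ennreal ((cmod (f x - rep_l2 (X m) x))\<^sup>2) \<partial>lborel) \<le> ennreal (e\<^sup>2)"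
    if "\<And>n. n \<ge> m \<Longrightarrow> norm (X n - X m) \<le> e" for m e
  proof -
    have "(\<integral>\<^sup>+x. ennreal ((cmod (f x - rep_l2 (X m) x))\<^sup>2) \<partial>lborel)
        = (\<integral>\<^sup>+x. liminf (\<lambda>n. ennreal ((cmod (rep_l2 (X n) x - rep_l2 (X m) x))\<^sup>2)) \<partial>lborel)"
    proof (rule nn_integral_cong_AE)
      show "AE x in lborel. ennreal ((cmod (f x - rep_l2 (X m) x))\<^sup>2)
          = liminf (\<lambda>n. ennreal ((cmod (rep_l2 (X n) x - rep_l2 (X m) x))\<^sup>2))"
        using lim
      proof eventually_elim
        fix x assume "(\<lambda>n. rep_l2 (X n) x) \<longlonglongrightarrow> f x"
        then have "(\<lambda>n. ennreal ((cmod (rep_l2 (X n) x - rep_l2 (X m) x))\<^sup>2))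
            \<longlonglongrightarrow> ennreal ((cmod (f x - rep_l2 (X m) x))\<^sup>2)"
          by (intro tendsto_intros)
        then show "ennreal ((cmod (f x - rep_l2 (X m) x))\<^sup>2)
            = liminf (\<lambda>n. ennreal ((cmod (rep_l2 (X n) x - rep_l2 (X m) x))\<^sup>2))"
          by (intro lim_imp_Liminf[symmetric]) auto
      qed
    qed
    also have "\<dots> \<le> liminf (\<lambda>n. \<integral>\<^sup>+x. ennreal ((cmod (rep_l2 (X n) x - rep_l2 (X m) x))\<^sup>2) \<partial>lborel)"
      by (rule nn_integral_liminf) measurable
    also have "\<dots> = liminf (\<lambda>n. ennreal ((norm (X n - X m))\<^sup>2))"
      by (simp add: nn_integral_l2_diff)
    also have "\<dots> \<le> liminf (\<lambda>n. ennreal (e\<^sup>2))"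
      using that by (intro Liminf_mono eventually_sequentiallyI[of m] ennreal_leI power_mono) auto
    also have "\<dots> = ennreal (e\<^sup>2)"
      by (simp add: Liminf_const)
    finally show ?thesis .
  qed
  obtain M where "\<And>n. norm (X n) \<le> M"
    using Cauchy_Bseq[OF C] by (auto simp: Bseq_def)
  then have "norm (X n - X 0) \<le> M + M" for n
    by (meson add_mono norm_triangle_ineq4 order_trans)
  note b0 = bound[of 0, OF this]
  have "sq_integrable (\<lambda>x. f x - rep_l2 (X 0) x)"
    unfolding sq_integrable_def
  proof
    show "integrable lborel (\<lambda>x. (cmod (f x - rep_l2 (X 0) x))\<^sup>2)"
      using b0 by (intro integrableI_nonneg) (auto simp: less_top[symmetric] top_unique)
  qed simp
  from sq_integrable_add[OF this sq_integrable_rep_l2[of "X 0"]] have f: "sq_integrable f"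
    by simp
  have "X \<longlonglongrightarrow> l2_class f"
  proof (rule metric_LIMSEQ_I)
    fix e :: real assume e: "0 < e"
    then obtain M where M: "\<And>m n. m \<ge> M \<Longrightarrow> n \<ge> M \<Longrightarrow> norm (X m - X n) < e / 2"
      using CauchyD[OF C, of "e/2"] by auto
    have "dist (X m) (l2_class f) < e" if m: "m \<ge> M" for m
    proof -
      have b: "(\<integral>\<^sup>+x. ennreal ((cmod (f x - rep_l2 (X m) x))\<^sup>2) \<partial>lborel) \<le> ennreal ((e/2)\<^sup>2)"
        using M m by (intro bound less_imp_le) auto
      have d: "sq_integrable (\<lambda>x. f x - rep_l2 (X m) x)"
        by (intro sq_integrable_diff f sq_integrable_rep_l2)
      have "l2_class f - X m = l2_class (\<lambda>x. f x - rep_l2 (X m) x)"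
        using l2_class_diff[OF f sq_integrable_rep_l2[of "X m"]] by (simp add: l2_class_rep)
      then have "(norm (l2_class f - X m))\<^sup>2 = (\<integral>x. (cmod (f x - rep_l2 (X m) x))\<^sup>2 \<partial>lborel)"
        using norm_l2_class[OF d] by simp
      then have "ennreal ((norm (l2_class f - X m))\<^sup>2) \<le> ennreal ((e/2)\<^sup>2)"
        using b d by (simp add: nn_integral_eq_integral sq_integrable_def)
      then have "(norm (l2_class f - X m))\<^sup>2 \<le> (e/2)\<^sup>2"
        by (subst (asm) ennreal_le_iff) auto
      then have "norm (l2_class f - X m) \<le> e / 2"
        by (rule power2_le_imp_le) (use e in simp)
      then show ?thesis
        using e by (simp add: dist_norm norm_minus_commute)
    qed
    then show "\<exists>M. \<forall>m\<ge>M. dist (X m) (l2_class f) < e"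
      by blast
  qed
  then show ?thesis
    by (auto simp: convergent_def)
qed

lemma Cauchy_fast_subseq:
  fixes X :: "nat \<Rightarrow> 'a::real_normed_vector"
  assumes C: "Cauchy X"
  obtains r where "strict_mono r" "\<And>n. norm (X (r (Suc n)) - X (r n)) \<le> (1/2) ^ n"
proof -
  have "\<exists>N. \<forall>i\<ge>N. \<forall>j\<ge>N. norm (X i - X j) < (1/2) ^ n" for n
    using CauchyD[OF C, of "(1/2) ^ n"] by auto
  then obtain N where N: "\<And>n i j. i \<ge> N n \<Longrightarrow> j \<ge> N n \<Longrightarrow> norm (X i - X j) < (1/2) ^ n"
    by metis
  define r where "r n = (\<Sum>i\<le>n. N i) + n" for n
  have ge: "N n \<le> r n" "r n < r (Suc n)" for n
    using member_le_sum[of n "{..n}" N] by (auto simp: r_def)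
  show ?thesis
  proof
    show "strict_mono r"
      using ge by (simp add: strict_mono_Suc_iff)
    show "norm (X (r (Suc n)) - X (r n)) \<le> (1/2) ^ n" for n
      by (rule less_imp_le, rule N) (use ge[of n] in \<open>auto\<close>)
  qed
qed

instance l2 :: (euclidean_space) banach
proof
  fix X :: "nat \<Rightarrow> 'a l2"
  assume C: "Cauchy X"
  obtain r where r: "strict_mono r" "\<And>n. norm (X (r (Suc n)) - X (r n)) \<le> (1/2) ^ n"
    using Cauchy_fast_subseq[OF C] by blast
  have "convergent (X \<circ> r)"
    using r Cauchy_subseq_Cauchy[OF C r(1)] by (intro l2_fast_Cauchy_imp_convergent) auto
  then show "convergent X"
    using Cauchy_converges_subseq[OF C r(1)] by (auto simp: convergent_def)
qed

section \<open>Integration by parts for test functions\<close>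

lemma test_function_differentiable:
  "\<phi> \<in> test_functions \<Omega> \<Longrightarrow> \<phi> differentiable (at x)"
  unfolding test_functions_def by (metis (mono_tags, lifting) Ck.simps(2) mem_Collect_eq)

lemma test_function_has_derivative:
  "\<phi> \<in> test_functions \<Omega> \<Longrightarrow> (\<phi> has_derivative frechet_derivative \<phi> (at x)) (at x)"
  using test_function_differentiable frechet_derivative_works by blast

lemma test_function_continuous:
  "\<phi> \<in> test_functions \<Omega> \<Longrightarrow> continuous_on UNIV \<phi>"
  using Ck.simps(1) unfolding test_functions_def by blast

lemma eq_0_outside_support: "x \<notin> closure {x. \<phi> x \<noteq> 0} \<Longrightarrow> \<phi> x = 0"
  using closure_subset[of "{x. \<phi> x \<noteq> 0}"] by auto

text \<open>The support does not grow, since a function vanishing on an open set has derivative \<open>0\<close>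
  there.\<close>

lemma test_function_partial_derivative:
  assumes \<phi>: "\<phi> \<in> test_functions \<Omega>" and b: "b \<in> Basis"
  shows "(\<lambda>x. frechet_derivative \<phi> (at x) b) \<in> test_functions \<Omega>"
proof -
  let ?K = "closure {x. \<phi> x \<noteq> 0}" and ?D = "\<lambda>x. frechet_derivative \<phi> (at x) b"
  have K: "compact ?K" "?K \<subseteq> \<Omega>" and C: "Ck k \<phi>" for k
    using \<phi> by (auto simp: test_functions_def)
  have "?D x = 0" if x: "x \<notin> ?K" for x
  proof -
    have "(\<phi> has_derivative (\<lambda>h. 0)) (at x)"
    proof (rule has_derivative_transform_within_open)
      show "((\<lambda>x. 0) has_derivative (\<lambda>h. 0)) (at x)"
        by simp
      show "open (- ?K)" "x \<in> - ?K"
        using x by auto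
      show "0 = \<phi> y" if "y \<in> - ?K" for y
        using that eq_0_outside_support[of y \<phi>] by simp
    qed
    then show ?thesis
      using frechet_derivative_at by (metis (no_types))
  qed
  then have "{x. ?D x \<noteq> 0} \<subseteq> ?K"
    by auto
  then have "closure {x. ?D x \<noteq> 0} \<subseteq> ?K"
    by (intro closure_minimal) auto
  moreover from this have "compact (closure {x. ?D x \<noteq> 0})"
    using compact_Int_closed[OF K(1) closed_closure, of "{x. ?D x \<noteq> 0}"]
    by (simp add: Int_absorb1)
  moreover have "Ck k ?D" for k
    using C[of "Suc k"] b by simp
  ultimately show ?thesis
    using K by (auto simp: test_functions_def)
qed

lemma integrable_continuous_compact_support:
  fixes f :: "'a::euclidean_space \<Rightarrow> 'b::{banach, second_countable_topology}"
  assumes "continuous_on UNIV f" "compact K" "\<And>x. x \<notin> K \<Longrightarrow> f x = 0"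
  shows "integrable lborel f"
proof -
  have "integrable lborel (\<lambda>x. indicator K x *\<^sub>R f x)"
    using assms by (intro borel_integrable_compact) (auto intro: continuous_on_subset)
  moreover have "(\<lambda>x. indicator K x *\<^sub>R f x) = f"
    using assms(3) by (auto simp: indicator_def)
  ultimately show ?thesis
    by simp
qed

lemma test_function_sq_integrable:
  assumes \<phi>: "\<phi> \<in> test_functions \<Omega>"
  shows "sq_integrable \<phi>"
  unfolding sq_integrable_def
proof
  show "\<phi> \<in> borel_measurable lborel"
    using test_function_continuous[OF \<phi>] by (simp add: borel_measurable_continuous_onI)
  show "integrable lborel (\<lambda>x. (cmod (\<phi> x))\<^sup>2)"
    using \<phi> eq_0_outside_support test_function_continuous[OF \<phi>]
    by (intro integrable_continuous_compact_support[of _ "closure {x. \<phi> x \<noteq> 0}"])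
      (auto simp: test_functions_def intro!: continuous_intros)
qed

text \<open>By translation invariance the difference quotients of \<open>f\<close> in direction \<open>b\<close> have integral
  \<open>0\<close>, and they converge dominatedly to the derivative.\<close>

lemma integral_directional_derivative_eq_0:
  fixes f :: "'a::euclidean_space \<Rightarrow> complex"
  assumes D: "\<And>x. (f has_derivative D x) (at x)"
    and cont: "continuous_on UNIV (\<lambda>x. D x b)"
    and K: "compact K" "\<And>x. x \<notin> K \<Longrightarrow> f x = 0" "\<And>x. x \<notin> K \<Longrightarrow> D x b = 0"
  shows "(\<integral>x. D x b \<partial>lborel) = 0"
proof -
  have fc: "continuous_on UNIV f"
    using D by (meson continuous_at_imp_continuous_on has_derivative_continuous)
  have int: "integrable lborel f"
    by (rule integrable_continuous_compact_support[OF fc K(1,2)])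
  have "compact ((\<lambda>x. D x b) ` K)"
    using cont K(1) by (intro compact_continuous_image) (auto intro: continuous_on_subset)
  then obtain M where "M > 0" and M0: "\<And>x. x \<in> K \<Longrightarrow> norm (D x b) \<le> M"
    using compact_imp_bounded bounded_pos by (metis (no_types, lifting) image_eqI)
  then have M: "norm (D x b) \<le> M" for x
    using K(3)[of x] by (cases "x \<in> K") auto
  obtain R where R: "\<And>x. x \<in> K \<Longrightarrow> norm x \<le> R"
    using K(1) compact_imp_bounded bounded_iff by metis
  define h where "h n = 1 / real (Suc n)" for n
  define q where "q n x = (1 / h n) *\<^sub>R (f (x + h n *\<^sub>R b) - f x)" for n x
  have h: "0 < h n" "h n \<le> 1" for n
    by (auto simp: h_def)
  have h0: "h \<longlonglongrightarrow> 0"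
    using LIMSEQ_inverse_real_of_nat by (simp add: h_def[abs_def] inverse_eq_divide)
  have curve: "((\<lambda>s. f (x + s *\<^sub>R b)) has_vector_derivative D (x + s *\<^sub>R b) b) (at s)" for x s
  proof -
    have "((\<lambda>s. x + s *\<^sub>R b) has_derivative (\<lambda>s. s *\<^sub>R b)) (at s)"
      by (auto intro!: derivative_eq_intros)
    from has_derivative_compose[OF this D] show ?thesis
      by (simp add: has_vector_derivative_def linear_cmul[OF has_derivative_linear[OF D]])
  qed
  have trans: "integrable lborel (\<lambda>x. f (x + c))" "(\<integral>x. f (x + c) \<partial>lborel) = (\<integral>x. f x \<partial>lborel)" for c
  proof -
    have [measurable]: "f \<in> borel_measurable borel"
      using fc by (rule borel_measurable_continuous_onI)
    have d: "distr lborel borel (\<lambda>x. x + c) = lborel"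
      using lborel_distr_plus[of c] by (simp only: add.commute[of _ c])
    show "integrable lborel (\<lambda>x. f (x + c))"
      using int integrable_distr_eq[of "\<lambda>x. x + c" lborel borel f] by (simp add: d)
    show "(\<integral>x. f (x + c) \<partial>lborel) = (\<integral>x. f x \<partial>lborel)"
      using integral_distr[of "\<lambda>x. x + c" lborel borel f] by (simp add: d)
  qed
  have q0: "(\<integral>x. q n x \<partial>lborel) = 0" for n
    using trans int by (simp add: q_def)
  have "(\<lambda>n. \<integral>x. q n x \<partial>lborel) \<longlonglongrightarrow> (\<integral>x. D x b \<partial>lborel)"
  proof (rule integral_dominated_convergence)
    \<comment> \<open>As \<open>0 < h n \<le> 1\<close>, this ball contains the supports of all difference quotients.\<close>
    let ?B = "cball 0 (R + norm b)"
    show "(\<lambda>x. D x b) \<in> borel_measurable lborel"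
      using cont by (simp add: borel_measurable_continuous_onI)
    show "q n \<in> borel_measurable lborel" for n
      unfolding q_def[abs_def] using trans int by auto
    show "integrable lborel (\<lambda>x. M * indicator ?B x)"
      by (intro integrable_mult_right integrable_real_indicator emeasure_bounded_finite)
        auto
    show "AE x in lborel. (\<lambda>n. q n x) \<longlonglongrightarrow> D x b"
    proof (intro AE_I2)
      fix x
      have "((\<lambda>t. (1 / t) *\<^sub>R (f (x + t *\<^sub>R b) - f x)) \<longlongrightarrow> D x b) (at 0)"
        using curve[of x 0] by (simp add: has_vector_derivative_iff_quotient)
      then show "(\<lambda>n. q n x) \<longlonglongrightarrow> D x b"
        unfolding q_def using h h0
        by (elim filterlim_compose)
          (auto simp: filterlim_at less_imp_neq[symmetric] intro!: always_eventually)
    qed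
    show "AE x in lborel. norm (q n x) \<le> M * indicator ?B x" for n
    proof (intro AE_I2)
      fix x
      show "norm (q n x) \<le> M * indicator ?B x"
      proof (cases "x \<in> ?B")
        case True
        have "norm (f (x + h n *\<^sub>R b) - f (x + 0 *\<^sub>R b)) \<le> M * h n"
        proof -
          have "\<exists>s\<in>{0<..<h n}. norm (f (x + h n *\<^sub>R b) - f (x + 0 *\<^sub>R b))
              \<le> norm ((h n - 0) *\<^sub>R D (x + s *\<^sub>R b) b)"
            using h(1) curve
            by (intro mvt_general[where f = "\<lambda>s. f (x + s *\<^sub>R b)"])
              (auto simp: has_vector_derivative_def intro!: continuous_at_imp_continuous_on
                has_vector_derivative_continuous[OF curve])
          then obtain s where "norm (f (x + h n *\<^sub>R b) - f (x + 0 *\<^sub>R b)) \<le> h n * norm (D (x + s *\<^sub>R b) b)"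
            using h(1)[of n] by auto
          also have "\<dots> \<le> h n * M"
            using h(1)[of n] M by (intro mult_left_mono) auto
          finally show ?thesis
            by (simp add: mult.commute)
        qed
        then show ?thesis
          using True h(1)[of n] by (simp add: q_def divide_le_eq)
      next
        case False
        have "norm (h n *\<^sub>R b) \<le> norm b"
          using h[of n] by (simp add: mult_left_le_one_le)
        moreover have "norm x \<le> norm (x + h n *\<^sub>R b) + norm (h n *\<^sub>R b)"
          by (metis add_diff_cancel_right' norm_triangle_ineq4)
        ultimately have "x \<notin> K" "x + h n *\<^sub>R b \<notin> K"
          using False R[of x] R[of "x + h n *\<^sub>R b"] norm_ge_zero[of b] by (fastforce simp: not_le)+
        then show ?thesis
          using K(2) False by (simp add: q_def indicator_def)
      qed
    qed
  qed
  then show ?thesis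
    using q0 by (simp add: LIMSEQ_const_iff)
qed

lemma test_function_integration_by_parts:
  assumes \<phi>: "\<phi> \<in> test_functions \<Omega>" and \<psi>: "\<psi> \<in> test_functions \<Omega>" and b: "b \<in> Basis"
  shows "cinner (l2_class (\<lambda>x. frechet_derivative \<phi> (at x) b)) (l2_class \<psi>)
    = - cinner (l2_class \<phi>) (l2_class (\<lambda>x. frechet_derivative \<psi> (at x) b))"
proof -
  let ?D\<phi> = "\<lambda>x. frechet_derivative \<phi> (at x)" and ?D\<psi> = "\<lambda>x. frechet_derivative \<psi> (at x)"
  note D\<phi> = test_function_partial_derivative[OF \<phi> b]
  note D\<psi> = test_function_partial_derivative[OF \<psi> b]
  note sq = test_function_sq_integrable[OF \<phi>] test_function_sq_integrable[OF \<psi>]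
    test_function_sq_integrable[OF D\<phi>] test_function_sq_integrable[OF D\<psi>]
  \<comment> \<open>The integrand is the derivative of the product of \<open>\<phi>\<close> and the conjugate of \<open>\<psi>\<close>.\<close>
  have "(\<integral>x. \<phi> x * cnj (?D\<psi> x b) + ?D\<phi> x b * cnj (\<psi> x) \<partial>lborel) = 0"
  proof (rule integral_directional_derivative_eq_0[where K = "closure {x. \<phi> x \<noteq> 0}
        \<union> closure {x. ?D\<phi> x b \<noteq> 0}"])
    show "((\<lambda>x. \<phi> x * cnj (\<psi> x)) has_derivative
        (\<lambda>h. \<phi> x * cnj (?D\<psi> x h) + ?D\<phi> x h * cnj (\<psi> x))) (at x)" for x
      by (intro has_derivative_mult test_function_has_derivative[OF \<phi>]
          bounded_linear.has_derivative[OF bounded_linear_cnj]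
          test_function_has_derivative[OF \<psi>])
    show "continuous_on UNIV (\<lambda>x. \<phi> x * cnj (?D\<psi> x b) + ?D\<phi> x b * cnj (\<psi> x))"
      by (intro continuous_intros test_function_continuous[OF \<phi>] test_function_continuous[OF \<psi>]
          test_function_continuous[OF D\<phi>] test_function_continuous[OF D\<psi>])
    show "compact (closure {x. \<phi> x \<noteq> 0} \<union> closure {x. ?D\<phi> x b \<noteq> 0})"
      using \<phi> D\<phi> by (intro compact_Un) (auto simp: test_functions_def)
  next
    fix x assume "x \<notin> closure {x. \<phi> x \<noteq> 0} \<union> closure {x. ?D\<phi> x b \<noteq> 0}"
    then have "\<phi> x = 0" "?D\<phi> x b = 0"
      using eq_0_outside_support[of x \<phi>] eq_0_outside_support[of x "\<lambda>x. ?D\<phi> x b"] by auto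
    then show "\<phi> x * cnj (\<psi> x) = 0" "\<phi> x * cnj (?D\<psi> x b) + ?D\<phi> x b * cnj (\<psi> x) = 0"
      by simp_all
  qed
  then have "(\<integral>x. \<phi> x * cnj (?D\<psi> x b) \<partial>lborel) + (\<integral>x. ?D\<phi> x b * cnj (\<psi> x) \<partial>lborel) = 0"
    using sq by (subst (asm) Bochner_Integration.integral_add) (auto intro!: sq_integrable_mult)
  then show ?thesis
    using sq by (simp add: cinner_l2.abs_eq l2_eq_def add_eq_0_iff2)
qed

text \<open>If \<open>\<phi>\<^sub>n \<longlonglongrightarrow> 0\<close> and \<open>\<partial>\<^sub>i\<phi>\<^sub>n \<longlonglongrightarrow> g\<close>, integration by parts makes \<open>g\<close> orthogonal to all test functions.
  The \<open>\<partial>\<^sub>i\<phi>\<^sub>n\<close> being test functions themselves, \<open>g\<close> is also a limit of test functions, hence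
  orthogonal to itself.\<close>

lemma H10_eq_0_if_fst_eq_0:
  assumes f: "f \<in> H10 \<Omega>" and 0: "fst f = 0"
  shows "f = 0"
proof -
  let ?T = "l2_class ` test_functions \<Omega>"
  have ax: "axis i (1::real) \<in> Basis" for i :: 'a
    by (simp add: axis_in_Basis_iff)
  have "snd f $ i = 0" for i
  proof -
    have orth: "cinner (snd f $ i) (l2_class \<psi>) = 0" if \<psi>: "\<psi> \<in> test_functions \<Omega>" for \<psi>
    proof -
      let ?w = "l2_class (\<lambda>x. frechet_derivative \<psi> (at x) (axis i 1))"
      let ?C = "{f. cinner (snd f $ i) (l2_class \<psi>) = - cinner (fst f) ?w}"
      have "closed ?C"
        by (intro closed_Collect_eq continuous_intros)
      moreover have "with_gradient ` test_functions \<Omega> \<subseteq> ?C"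
        using test_function_integration_by_parts[OF _ \<psi> ax] by (auto simp: with_gradient_def)
      ultimately have "H10 \<Omega> \<subseteq> ?C"
        unfolding H10_def by (rule closure_minimal[rotated])
      then show ?thesis
        using f 0 by auto
    qed
    have "(\<lambda>f. snd f $ i) ` H10 \<Omega> \<subseteq> closure ?T"
      unfolding H10_def
    proof (rule image_closure_subset)
      show "(\<lambda>f. snd f $ i) ` with_gradient ` test_functions \<Omega> \<subseteq> closure ?T"
        using test_function_partial_derivative[OF _ ax] closure_subset[of ?T]
        by (fastforce simp: with_gradient_def)
    qed (auto intro!: continuous_intros)
    moreover have "closure ?T \<subseteq> {g. cinner (snd f $ i) g = 0}"
    proof (rule closure_minimal)
      show "closed {g. cinner (snd f $ i) g = 0}"
        by (intro closed_Collect_eq continuous_intros)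
    qed (use orth in \<open>auto\<close>)
    ultimately have "cinner (snd f $ i) (snd f $ i) = 0"
      using f by blast
    then show ?thesis
      by simp
  qed
  then show ?thesis
    using 0 by (simp add: prod_eq_iff vec_eq_iff)
qed

section \<open>Test functions on the real line\<close>

lemma has_derivative_real_imp_has_vector_derivative:
  fixes x :: real
  assumes "(f has_derivative D) (at x)"
  shows "(f has_vector_derivative D 1) (at x)"
proof -
  have "D = (\<lambda>h. h *\<^sub>R D 1)"
  proof
    show "D h = h *\<^sub>R D 1" for h
      using linear_cmul[OF has_derivative_linear[OF assms], of h 1] by simp
  qed
  then show ?thesis
    unfolding has_vector_derivative_def by (rule has_derivative_eq_rhs[OF assms])
qed

text \<open>On the line, \<^const>\<open>Ck\<close> with its Frechet derivatives in basis directions reduces to ordinary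
  derivatives; this makes the closure properties below straightforward inductions.\<close>

lemma Ck_Suc_real:
  fixes f :: "real \<Rightarrow> complex"
  shows "Ck (Suc k) f \<longleftrightarrow> (\<exists>f'. (\<forall>x. (f has_vector_derivative f' x) (at x)) \<and> Ck k f')"
proof
  assume "Ck (Suc k) f"
  then have d: "(f has_derivative frechet_derivative f (at x)) (at x)"
    and c: "Ck k (\<lambda>x. frechet_derivative f (at x) 1)" for x
    using frechet_derivative_works by auto
  have "(f has_vector_derivative frechet_derivative f (at x) 1) (at x)" for x
    by (rule has_derivative_real_imp_has_vector_derivative[OF d])
  with c show "\<exists>f'. (\<forall>x. (f has_vector_derivative f' x) (at x)) \<and> Ck k f'"
    by (intro exI[of _ "\<lambda>x. frechet_derivative f (at x) 1"]) simp
next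
  assume "\<exists>f'. (\<forall>x. (f has_vector_derivative f' x) (at x)) \<and> Ck k f'"
  then obtain f' where f': "\<And>x. (f has_vector_derivative f' x) (at x)" "Ck k f'"
    by blast
  have "frechet_derivative f (at x) = (\<lambda>h. h *\<^sub>R f' x)" for x
    using f'(1)[of x] frechet_derivative_at unfolding has_vector_derivative_def by metis
  with f' show "Ck (Suc k) f"
    by (auto simp: has_vector_derivative_def differentiable_def)
qed

lemma Ck_SucD:
  fixes f :: "real \<Rightarrow> complex"
  shows "Ck (Suc k) f \<Longrightarrow> Ck k f"
proof (induction k arbitrary: f)
  case 0
  then show ?case
    by (auto simp: Ck_Suc_real simp del: Ck.simps(2)
        intro!: continuous_at_imp_continuous_on dest: has_vector_derivative_continuous)
next
  case (Suc k)
  then show ?case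
    by (metis Ck_Suc_real)
qed

lemma Ck_const: "Ck k (\<lambda>x::real. c)"
proof (induction k arbitrary: c)
  case (Suc k)
  show ?case
    unfolding Ck_Suc_real using Suc[of 0] by (intro exI[of _ "\<lambda>x. 0"]) auto
qed simp

lemma Ck_add:
  fixes f g :: "real \<Rightarrow> complex"
  shows "Ck k f \<Longrightarrow> Ck k g \<Longrightarrow> Ck k (\<lambda>x. f x + g x)"
proof (induction k arbitrary: f g)
  case (Suc k)
  then obtain f' g' where "\<And>x. (f has_vector_derivative f' x) (at x)" "Ck k f'"
    "\<And>x. (g has_vector_derivative g' x) (at x)" "Ck k g'"
    unfolding Ck_Suc_real by blast
  then show ?case
    unfolding Ck_Suc_real
    by (intro exI[of _ "\<lambda>x. f' x + g' x"]) (auto intro: has_vector_derivative_add Suc.IH)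
qed (auto intro: continuous_intros)

lemma Ck_mult:
  fixes f g :: "real \<Rightarrow> complex"
  shows "Ck k f \<Longrightarrow> Ck k g \<Longrightarrow> Ck k (\<lambda>x. f x * g x)"
proof (induction k arbitrary: f g)
  case (Suc k)
  then obtain f' g' where fg: "\<And>x. (f has_vector_derivative f' x) (at x)" "Ck k f'"
    "\<And>x. (g has_vector_derivative g' x) (at x)" "Ck k g'"
    unfolding Ck_Suc_real by blast
  then show ?case
    unfolding Ck_Suc_real
    using Ck_SucD[OF Suc.prems(1)] Ck_SucD[OF Suc.prems(2)]
    by (intro exI[of _ "\<lambda>x. f x * g' x + f' x * g x"])
      (auto intro!: has_vector_derivative_mult Ck_add Suc.IH)
qed (auto intro: continuous_intros)

lemma Ck_affine:
  fixes f :: "real \<Rightarrow> complex"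
  shows "Ck k f \<Longrightarrow> Ck k (\<lambda>x. f (c * x + d))"
proof (induction k arbitrary: f)
  case 0
  then show ?case
    by (auto intro!: continuous_intros continuous_on_compose2[of UNIV f])
next
  case (Suc k)
  then obtain f' where f': "\<And>x. (f has_vector_derivative f' x) (at x)" "Ck k f'"
    unfolding Ck_Suc_real by blast
  have "((\<lambda>x. f (c * x + d)) has_vector_derivative of_real c * f' (c * x + d)) (at x)" for x
  proof -
    have "((\<lambda>x. c * x + d) has_vector_derivative c) (at x)"
      by (auto intro!: derivative_eq_intros)
    from vector_diff_chain_at[OF this f'(1)] show ?thesis
      by (simp add: o_def scaleR_conv_of_real)
  qed
  then show ?case
    unfolding Ck_Suc_real using f'(2)
    by (intro exI[of _ "\<lambda>x. of_real c * f' (c * x + d)"]) (auto intro: Ck_mult Ck_const Suc.IH)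
qed

text \<open>The functions \<open>x\<^sup>-\<^sup>k exp (-1/x)\<close>, extended by \<open>0\<close> to \<open>x \<le> 0\<close>: the derivative of one is a
  linear combination of two others, so all of them are smooth.\<close>

definition flat :: "nat \<Rightarrow> real \<Rightarrow> real" where
  "flat k x = (if x \<le> 0 then 0 else inverse x ^ k * exp (- inverse x))"

lemma flat_tendsto_0: "(flat k \<longlongrightarrow> 0) (at 0)"
proof (rule filterlim_split_at)
  have "\<forall>\<^sub>F x in at_left 0. flat k x = 0"
    by (auto simp: eventually_at_filter flat_def)
  then show "(flat k \<longlongrightarrow> 0) (at_left 0)"
    by (simp add: tendsto_eventually)
  have "((\<lambda>y. y ^ k / exp y) \<longlongrightarrow> 0) (at_top :: real filter)"
    by (rule tendsto_power_div_exp_0)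
  then have "((\<lambda>x. inverse x ^ k / exp (inverse x)) \<longlongrightarrow> 0) (at_right (0::real))"
    by (rule filterlim_compose) (rule filterlim_inverse_at_top_right)
  moreover have "\<forall>\<^sub>F x in at_right 0. inverse x ^ k / exp (inverse x) = flat k x"
    by (auto simp: eventually_at_filter flat_def exp_minus divide_inverse)
  ultimately show "(flat k \<longlongrightarrow> 0) (at_right 0)"
    by (rule Lim_transform_eventually)
qed

lemma flat_has_derivative:
  "(flat k has_real_derivative flat (k + 2) x - real k * flat (k + 1) x) (at x)"
proof -
  consider "x < 0" | "x = 0" | "x > 0"
    by linarith
  then show ?thesis
  proof cases
    case 1
    have "((\<lambda>x. 0) has_real_derivative 0) (at x)"
      by simp
    then have "(flat k has_real_derivative 0) (at x)"
      by (rule has_field_derivative_transform_within_open[where S = "{..<0}"]) (use 1 in \<open>auto simp: flat_def\<close>)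
    with 1 show ?thesis
      by (simp add: flat_def)
  next
    case 2
    have "\<forall>\<^sub>F h in at 0. flat (k + 1) h = (flat k (0 + h) - flat k 0) / h"
      by (auto simp: eventually_at_filter flat_def field_simps)
    from Lim_transform_eventually[OF flat_tendsto_0 this] show ?thesis
      unfolding 2 DERIV_def by (simp add: flat_def)
  next
    case 3
    have inv: "(inverse has_real_derivative - (inverse x ^ 2)) (at x)"
      using DERIV_inverse[of x] 3 by (simp add: power2_eq_square)
    have "((\<lambda>x. inverse x ^ k) has_real_derivative - (real k * inverse x ^ (k + 1))) (at x)"
    proof (cases k)
      case (Suc m)
      show ?thesis
        unfolding Suc by (rule DERIV_cong[OF DERIV_power_Suc[OF inv]])
          (simp add: power2_eq_square algebra_simps)
    qed simp
    from DERIV_mult[OF this DERIV_fun_exp[OF DERIV_minus[OF inv]]]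
    have "((\<lambda>x. inverse x ^ k * exp (- inverse x)) has_real_derivative
        flat (k + 2) x - real k * flat (k + 1) x) (at x)"
      by (rule DERIV_cong) (use 3 in \<open>simp add: flat_def power2_eq_square algebra_simps\<close>)
    then show ?thesis
      by (rule has_field_derivative_transform_within_open[where S = "{0<..}"]) (use 3 in \<open>auto simp: flat_def\<close>)
  qed
qed

lemma Ck_flat: "Ck n (\<lambda>x. complex_of_real (flat k x))"
proof (induction n arbitrary: k)
  case 0
  show ?case
    using flat_has_derivative[of k]
    by (auto intro!: continuous_intros continuous_at_imp_continuous_on DERIV_isCont)
next
  case (Suc n)
  have "((\<lambda>x. complex_of_real (flat k x)) has_vector_derivative
      of_real (flat (k + 2) x) + - of_nat k * of_real (flat (k + 1) x)) (at x)" for x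
    using has_vector_derivative_of_real[OF flat_has_derivative[of k x]] by simp
  moreover have "Ck n (\<lambda>x. of_real (flat (k + 2) x) + - of_nat k * of_real (flat (k + 1) x))"
    by (rule Ck_add[OF Suc.IH Ck_mult[OF Ck_const Suc.IH]])
  ultimately show ?case
    unfolding Ck_Suc_real
    by (intro exI[of _ "\<lambda>x. of_real (flat (k + 2) x) + - of_nat k * of_real (flat (k + 1) x)"]) simp
qed

lemma test_function_realI:
  fixes \<phi> :: "real \<Rightarrow> complex"
  assumes "\<And>k. Ck k \<phi>" "\<And>s. r < \<bar>s\<bar> \<Longrightarrow> \<phi> s = 0"
  shows "\<phi> \<in> test_functions UNIV"
proof -
  have "{s. \<phi> s \<noteq> 0} \<subseteq> cball 0 r"
    using assms(2) by (force simp: dist_real_def)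
  then have "bounded {s. \<phi> s \<noteq> 0}"
    using bounded_cball bounded_subset by blast
  with assms(1) show ?thesis
    by (simp add: test_functions_def compact_closure)
qed

lemma test_function_realE:
  fixes \<phi> :: "real \<Rightarrow> complex"
  assumes "\<phi> \<in> test_functions UNIV"
  obtains r where "r > 0" "\<And>s. r < \<bar>s\<bar> \<Longrightarrow> \<phi> s = 0"
proof -
  have "bounded (closure {s. \<phi> s \<noteq> 0})"
    using assms by (auto simp: test_functions_def compact_imp_bounded)
  then obtain r where "r > 0" "\<And>s. s \<in> closure {s. \<phi> s \<noteq> 0} \<Longrightarrow> norm s \<le> r"
    unfolding bounded_pos by blast
  with eq_0_outside_support[of _ \<phi>] that show ?thesis
    by (metis not_le real_norm_def)
qed

lemma test_function_shift:
  assumes "\<phi> \<in> test_functions (UNIV :: real set)"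
  shows "(\<lambda>s. \<phi> (s - t)) \<in> test_functions UNIV"
proof -
  obtain r where r: "\<And>s. r < \<bar>s\<bar> \<Longrightarrow> \<phi> s = 0"
    using test_function_realE[OF assms] by blast
  have "Ck k (\<lambda>s. \<phi> (s - t))" for k
    using Ck_affine[of k \<phi> 1 "- t"] assms by (simp add: test_functions_def)
  then show ?thesis
    by (rule test_function_realI[where r = "r + \<bar>t\<bar>"]) (auto intro!: r)
qed

lemma test_function_real_derivative:
  fixes \<phi> :: "real \<Rightarrow> complex"
  assumes \<phi>: "\<phi> \<in> test_functions UNIV"
  obtains \<phi>' where "\<phi>' \<in> test_functions UNIV" "\<And>s. (\<phi> has_vector_derivative \<phi>' s) (at s)"
proof
  let ?D = "\<lambda>s. frechet_derivative \<phi> (at s) 1"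
  show "?D \<in> test_functions UNIV"
    by (rule test_function_partial_derivative[OF \<phi>]) simp
  show "(\<phi> has_vector_derivative ?D s) (at s)" for s
    by (rule has_derivative_real_imp_has_vector_derivative[OF test_function_has_derivative[OF \<phi>]])
qed

text \<open>Both factors of \<open>flat 0 (\<delta> + s) * flat 0 (\<delta> - s)\<close> are positive exactly for \<open>|s| < \<delta>\<close>, so this is a
  bump function, to be normalized.\<close>

lemma approximate_identity_exists:
  fixes \<delta> :: real
  assumes \<delta>: "0 < \<delta>"
  obtains b :: "real \<Rightarrow> real" where "(\<lambda>s. complex_of_real (b s)) \<in> test_functions UNIV"
    "\<And>s. 0 \<le> b s" "\<And>s. \<delta> \<le> \<bar>s\<bar> \<Longrightarrow> b s = 0" "(b has_integral 1) {-\<delta>..\<delta>}"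
proof -
  define g where "g s = flat 0 (\<delta> + s) * flat 0 (\<delta> - s)" for s
  have g0: "0 \<le> g s" for s
    by (simp add: g_def flat_def)
  have gout: "g s = 0" if "\<delta> \<le> \<bar>s\<bar>" for s
    using that by (auto simp: g_def flat_def)
  have Ck: "Ck k (\<lambda>s. complex_of_real (g s))" for k
    using Ck_mult[OF Ck_affine[where c = 1 and d = \<delta>, OF Ck_flat[of k 0]]
        Ck_affine[where c = "-1" and d = \<delta>, OF Ck_flat[of k 0]]]
    by (simp add: g_def add.commute)
  have "continuous_on UNIV (\<lambda>s. Re (complex_of_real (g s)))"
    using Ck[of 0] by (intro continuous_intros) simp
  then have cont: "continuous_on {-\<delta>..\<delta>} g"
    by (auto intro: continuous_on_subset)
  define c where "c = integral {-\<delta>..\<delta>} g"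
  have gi: "(g has_integral c) {-\<delta>..\<delta>}"
    using integrable_continuous_real[OF cont] by (simp add: c_def has_integral_integral)
  have "0 \<le> c"
    unfolding c_def by (rule integral_nonneg) (use gi g0 in \<open>auto\<close>)
  moreover have "c \<noteq> 0"
  proof
    assume "c = 0"
    then have "g 0 = 0"
      using integral_eq_0_iff[OF cont] g0 \<delta> unfolding c_def by auto
    then show False
      using \<delta> by (simp add: g_def flat_def)
  qed
  ultimately have c: "0 < c"
    by simp
  show ?thesis
  proof
    show "(\<lambda>s. complex_of_real (g s / c)) \<in> test_functions UNIV"
      using Ck_mult[OF Ck_const[of _ "1 / of_real c"] Ck] gout
      by (intro test_function_realI[where r = \<delta>]) auto
    show "((\<lambda>s. g s / c) has_integral 1) {-\<delta>..\<delta>}"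
      using has_integral_divide[OF gi, of c] c by simp
  qed (use g0 c gout in \<open>auto\<close>)
qed

section \<open>Integrals with values in a closed subspace\<close>

lemma tagged_division_sum_in_subspace:
  assumes "subspace V" "p tagged_division_of cbox a b" "\<And>x. x \<in> cbox a b \<Longrightarrow> f x \<in> V"
  shows "(\<Sum>(x, k)\<in>p. measure lborel k *\<^sub>R f x) \<in> V"
proof (rule subspace_sum[OF assms(1)])
  fix z assume z: "z \<in> p"
  obtain x k where xk: "z = (x, k)"
    by (cases z)
  have "x \<in> cbox a b"
    using tagged_division_ofD(2,3)[OF assms(2), of x k] z xk by blast
  then show "(case z of (x, k) \<Rightarrow> measure lborel k *\<^sub>R f x) \<in> V"
    using assms(1,3) by (simp add: xk subspace_scale)
qed

text \<open>Riemann sums lie in the subspace and approximate the integral.\<close>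

lemma has_integral_in_closed_subspace:
  assumes V: "subspace V" "closed V" and i: "(f has_integral y) (cbox a b)"
    and f: "\<And>x. x \<in> cbox a b \<Longrightarrow> f x \<in> V"
  shows "y \<in> V"
proof -
  have "\<exists>v\<in>V. dist v y < e" if e: "0 < e" for e
  proof -
    from i[unfolded has_integral, rule_format, OF e]
    obtain \<gamma> where \<gamma>: "gauge \<gamma>" "\<forall>p. p tagged_division_of cbox a b \<and> \<gamma> fine p \<longrightarrow>
        norm ((\<Sum>(x, k)\<in>p. measure lborel k *\<^sub>R f x) - y) < e"
      by (elim exE conjE)
    obtain p where p: "p tagged_division_of cbox a b" "\<gamma> fine p"
      using fine_division_exists[OF \<gamma>(1)] by blast
    show ?thesis
      using \<gamma>(2)[rule_format, OF conjI[OF p]] tagged_division_sum_in_subspace[OF V(1) p(1), of f] f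
      by (auto simp: dist_norm)
  qed
  then have "y \<in> closure V"
    by (simp add: closure_approachable)
  with V show ?thesis
    by simp
qed

lemma clinear_from_to_sum:
  assumes T: "clinear_from_to V H T" and g: "\<And>i. i \<in> I \<Longrightarrow> g i \<in> V"
  shows "T (\<Sum>i\<in>I. c i *\<^sub>R g i) = (\<Sum>i\<in>I. c i *\<^sub>R T (g i))"
  using g
proof (induction I rule: infinite_finite_induct)
  case (insert i I)
  note lin = clinear_from_toD[OF T]
  note V = csubspace_imp_subspace[OF lin(1)]
  have "(\<Sum>i\<in>I. c i *\<^sub>R g i) \<in> V" "c i *\<^sub>R g i \<in> V"
    using insert.prems by (auto intro!: subspace_sum[OF V] subspace_scale[OF V])
  with insert show ?case
    by (simp add: lin)
qed (simp_all add: clinear_from_toD[OF T])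

text \<open>The operator is bounded only on the subspace, so linearity and boundedness are applied to
  the Riemann sums.\<close>

lemma has_integral_bounded_op:
  assumes T: "bounded_op H T" and H: "closed H" and i: "(f has_integral y) (cbox a b)"
    and f: "\<And>x. x \<in> cbox a b \<Longrightarrow> f x \<in> H"
  shows "((\<lambda>x. T (f x)) has_integral T y) (cbox a b)"
  unfolding has_integral
proof (intro allI impI)
  fix e :: real assume e: "0 < e"
  note lin = clinear_from_toD[OF bounded_op_clinear[OF T]]
  note V = csubspace_imp_subspace[OF lin(1)]
  have y: "y \<in> H"
    using has_integral_in_closed_subspace[OF V H i f] .
  obtain K where K: "K > 0" "\<And>x. x \<in> H \<Longrightarrow> norm (T x) \<le> K * norm x"
    using bounded_opE[OF T] by blast
  from i[unfolded has_integral, rule_format, OF divide_pos_pos[OF e K(1)]]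
  obtain \<gamma> where \<gamma>: "gauge \<gamma>" "\<forall>p. p tagged_division_of cbox a b \<and> \<gamma> fine p \<longrightarrow>
      norm ((\<Sum>(x, k)\<in>p. measure lborel k *\<^sub>R f x) - y) < e / K"
    by (elim exE conjE)
  have "norm ((\<Sum>(x, k)\<in>p. measure lborel k *\<^sub>R T (f x)) - T y) < e"
    if p: "p tagged_division_of cbox a b" "\<gamma> fine p" for p
  proof -
    let ?S = "\<Sum>(x, k)\<in>p. measure lborel k *\<^sub>R f x"
    have S: "?S \<in> H"
      by (rule tagged_division_sum_in_subspace[OF V p(1) f])
    have "f (fst z) \<in> H" if "z \<in> p" for z
      using tagged_division_ofD(2,3)[OF p(1), of "fst z" "snd z"] f[of "fst z"] that by auto
    then have "(\<Sum>(x, k)\<in>p. measure lborel k *\<^sub>R T (f x)) = T ?S"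
      using clinear_from_to_sum[OF bounded_op_clinear[OF T], of p "\<lambda>z. f (fst z)" "\<lambda>z. measure lborel (snd z)"]
      by (simp add: case_prod_unfold)
    then have "norm ((\<Sum>(x, k)\<in>p. measure lborel k *\<^sub>R T (f x)) - T y) \<le> K * norm (?S - y)"
      using K(2)[OF csubspace_diff[OF lin(1) S y]] lin(7)[OF S y] by simp
    also have "\<dots> < e"
      using \<gamma>(2)[rule_format, OF conjI[OF p]] K(1) by (simp add: field_simps)
    finally show ?thesis .
  qed
  with \<gamma>(1) show "\<exists>\<gamma>. gauge \<gamma> \<and> (\<forall>p. p tagged_division_of cbox a b \<and> \<gamma> fine p \<longrightarrow>
      norm ((\<Sum>(x, k)\<in>p. measure lborel k *\<^sub>R T (f x)) - T y) < e)"
    by (intro exI[of _ \<gamma>]) simp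
qed

section \<open>Smeared vectors of a strongly continuous group\<close>

locale operator_group =
  fixes H :: "'a::{complex_inner, banach} set" and G :: "real \<Rightarrow> 'a \<Rightarrow> 'a"
  assumes closed: "closed H"
    and bounded: "\<And>t. bounded_op H (G t)"
    and group: "strongly_continuous_group H G"
begin

lemmas lin = clinear_from_toD[OF bounded_op_clinear[OF bounded]]
lemmas csubspace = lin(1)
lemmas in_H = lin(2)

lemma group_0: "x \<in> H \<Longrightarrow> G 0 x = x"
  and group_add: "x \<in> H \<Longrightarrow> G (t + s) x = G t (G s x)"
  and group_continuous: "x \<in> H \<Longrightarrow> continuous_on UNIV (\<lambda>t. G t x)"
  using group by (auto simp: strongly_continuous_group_def)

text \<open>Differentiability propagates from \<open>0\<close> because \<open>G(t + s)x = G(t) G(s)x\<close> and \<open>G(t)\<close> is bounded.\<close>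

lemma has_vector_derivative_at_0_imp:
  assumes x: "x \<in> H" "x' \<in> H" and d: "((\<lambda>t. G t x) has_vector_derivative x') (at 0)"
  shows "((\<lambda>t. G t x) has_vector_derivative G t x') (at t)"
proof -
  have "((\<lambda>s. G t (G s x)) has_vector_derivative G t x') (at 0)"
    using x in_H by (intro bounded_op_has_vector_derivative[OF bounded _ _ d])
  then show ?thesis
    using x by (simp add: has_vector_derivative_iff_quotient group_add[symmetric])
qed

lemma smeared_has_integral:
  assumes f: "f \<in> H" and \<phi>: "continuous_on UNIV \<phi>" "\<And>s. s \<notin> {a..b} \<Longrightarrow> \<phi> s = 0"
  shows "((\<lambda>s. \<phi> s *\<^sub>C G s f) has_integral smeared G \<phi> f) {a..b}"
proof -
  have "continuous_on {a..b} (\<lambda>s. \<phi> s *\<^sub>C G s f)"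
    using group_continuous[OF f] \<phi>(1)
    by (intro continuous_intros) (auto intro: continuous_on_subset)
  then have *: "(\<lambda>s. \<phi> s *\<^sub>C G s f) integrable_on {a..b}"
    by (rule integrable_continuous_real)
  have "(\<lambda>s. if s \<in> {a..b} then \<phi> s *\<^sub>C G s f else 0) = (\<lambda>s. \<phi> s *\<^sub>C G s f)"
    using \<phi>(2) by auto
  from arg_cong[OF this, of "integral UNIV"]
  have "smeared G \<phi> f = integral {a..b} (\<lambda>s. \<phi> s *\<^sub>C G s f)"
    unfolding smeared_def integral_restrict_UNIV by (rule sym)
  with * show ?thesis
    by (simp add: has_integral_integral)
qed

lemma smeared_in_H:
  assumes f: "f \<in> H" and \<phi>: "\<phi> \<in> test_functions UNIV"
  shows "smeared G \<phi> f \<in> H"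
proof -
  obtain r where r: "\<And>s. r < \<bar>s\<bar> \<Longrightarrow> \<phi> s = 0"
    using test_function_realE[OF \<phi>] by blast
  have "((\<lambda>s. \<phi> s *\<^sub>C G s f) has_integral smeared G \<phi> f) (cbox (-r) r)"
    using r unfolding box_real
    by (intro smeared_has_integral[OF f] test_function_continuous[OF \<phi>]) auto
  then show ?thesis
    by (rule has_integral_in_closed_subspace[OF csubspace_imp_subspace[OF csubspace] closed])
      (intro csubspace_scaleC[OF csubspace] in_H f)
qed

text \<open>\<open>G(t) \<integral> \<phi>(s) G(s)f ds = \<integral> \<phi>(s) G(t + s)f ds = \<integral> \<phi>(s - t) G(s)f ds\<close>.\<close>

lemma group_smeared:
  assumes f: "f \<in> H" and \<phi>: "\<phi> \<in> test_functions UNIV"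
  shows "G t (smeared G \<phi> f) = smeared G (\<lambda>s. \<phi> (s - t)) f"
proof -
  obtain r where r: "\<And>s. r < \<bar>s\<bar> \<Longrightarrow> \<phi> s = 0"
    using test_function_realE[OF \<phi>] by blast
  have "((\<lambda>s. \<phi> s *\<^sub>C G s f) has_integral smeared G \<phi> f) (cbox (-r) r)"
    using r unfolding box_real
    by (intro smeared_has_integral[OF f] test_function_continuous[OF \<phi>]) auto
  then have "((\<lambda>s. G t (\<phi> s *\<^sub>C G s f)) has_integral G t (smeared G \<phi> f)) (cbox (-r) r)"
    by (rule has_integral_bounded_op[OF bounded closed])
      (intro csubspace_scaleC[OF csubspace] in_H f)
  then have "((\<lambda>s. \<phi> s *\<^sub>C G (t + s) f) has_integral G t (smeared G \<phi> f)) {-r..r}"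
    using f in_H by (simp add: lin(4) group_add)
  from has_integral_shift_real_ivl[OF this, of "- t"]
  have "((\<lambda>s. \<phi> (s - t) *\<^sub>C G s f) has_integral G t (smeared G \<phi> f)) {-r+t..r+t}"
    by simp
  moreover have "((\<lambda>s. \<phi> (s - t) *\<^sub>C G s f) has_integral smeared G (\<lambda>s. \<phi> (s - t)) f) {-r+t..r+t}"
    using r
    by (intro smeared_has_integral[OF f] test_function_continuous[OF test_function_shift[OF \<phi>]]) auto
  ultimately show ?thesis
    by (rule has_integral_unique)
qed

text \<open>By the previous lemma the parameter \<open>t\<close> can be moved into the smooth weight, so one differentiates
  under the integral sign.\<close>

lemma smeared_has_vector_derivative:
  assumes f: "f \<in> H" and \<phi>: "\<phi> \<in> test_functions UNIV" and \<phi>': "\<phi>' \<in> test_functions UNIV"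
    and d: "\<And>s. (\<phi> has_vector_derivative \<phi>' s) (at s)"
  shows "((\<lambda>t. G t (smeared G \<phi> f)) has_vector_derivative - smeared G \<phi>' f) (at 0)"
proof -
  obtain r1 where r1: "\<And>s. r1 < \<bar>s\<bar> \<Longrightarrow> \<phi> s = 0"
    using test_function_realE[OF \<phi>] by blast
  obtain r2 where r2: "\<And>s. r2 < \<bar>s\<bar> \<Longrightarrow> \<phi>' s = 0"
    using test_function_realE[OF \<phi>'] by blast
  \<comment> \<open>One interval that contains the support of \<open>\<phi>(s - t)\<close> for all \<open>t \<in> [-1, 1]\<close>.\<close>
  define r where "r = max r1 r2 + 1"
  let ?F = "\<lambda>t. integral {-r..r} (\<lambda>s. \<phi> (s - t) *\<^sub>C G s f)"
  have "(?F has_vector_derivative integral {-r..r} (\<lambda>s. - \<phi>' (s - 0) *\<^sub>C G s f)) (at 0 within {-1..1})"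
    unfolding box_real(2)[symmetric, of "-r"]
  proof (rule leibniz_rule_vector_derivative)
    show "((\<lambda>t. \<phi> (s - t) *\<^sub>C G s f) has_vector_derivative - \<phi>' (s - t) *\<^sub>C G s f) (at t within {-1..1})"
      for s t
    proof -
      have "((\<lambda>t. s - t) has_vector_derivative -1) (at t)"
        by (auto intro!: derivative_eq_intros)
      from vector_diff_chain_at[OF this d]
      have "((\<lambda>t. \<phi> (s - t)) has_vector_derivative - \<phi>' (s - t)) (at t)"
        by (simp add: o_def)
      from has_vector_derivative_scaleC[OF this has_vector_derivative_const, of "G s f"]
      show ?thesis
        by (simp add: has_vector_derivative_at_within)
    qed
    show "(\<lambda>s. \<phi> (s - t) *\<^sub>C G s f) integrable_on cbox (-r) r" for t
      using group_continuous[OF f] test_function_continuous[OF test_function_shift[OF \<phi>]]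
      by (intro integrable_continuous continuous_intros) (auto intro: continuous_on_subset)
    show "continuous_on ({-1..1} \<times> cbox (-r) r) (\<lambda>(t, s). - \<phi>' (s - t) *\<^sub>C G s f)"
      unfolding case_prod_unfold
      by (intro continuous_intros continuous_on_compose2[OF group_continuous[OF f]]
          continuous_on_compose2[OF test_function_continuous[OF \<phi>']]) auto
  qed auto
  moreover have "((\<lambda>s. \<phi>' s *\<^sub>C G s f) has_integral smeared G \<phi>' f) {-r..r}"
    using r2 by (intro smeared_has_integral[OF f] test_function_continuous[OF \<phi>']) (auto simp: r_def)
  then have "integral {-r..r} (\<lambda>s. - \<phi>' (s - 0) *\<^sub>C G s f) = - smeared G \<phi>' f"
    by (simp add: bounded_bilinear.minus_left[OF bounded_bilinear_scaleC] integral_unique)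
  ultimately have F: "(?F has_vector_derivative - smeared G \<phi>' f) (at 0)"
    by (simp add: at_within_Icc_at)
  have "?F t = G t (smeared G \<phi> f)" if "t \<in> {-1<..<1}" for t
  proof -
    have "((\<lambda>s. \<phi> (s - t) *\<^sub>C G s f) has_integral smeared G (\<lambda>s. \<phi> (s - t)) f) {-r..r}"
      using r1 that
      by (intro smeared_has_integral[OF f] test_function_continuous[OF test_function_shift[OF \<phi>]])
        (auto simp: r_def)
    then show ?thesis
      using group_smeared[OF f \<phi>] by (simp add: integral_unique)
  qed
  then show ?thesis
    by (intro has_vector_derivative_transform_within_open[OF F, of "{-1<..<1}"]) auto
qed

text \<open>For \<open>\<phi> \<ge> 0\<close> with integral \<open>1\<close>, the smeared vector is an average of the \<open>G(s)f\<close>, which are close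
  to \<open>f\<close> on the small support of \<open>\<phi>\<close>.\<close>

lemma smeared_approximates:
  assumes f: "f \<in> H" and e: "0 < e"
  obtains \<phi> where "\<phi> \<in> test_functions UNIV" "dist (smeared G \<phi> f) f < e"
proof -
  have "continuous (at 0) (\<lambda>t. G t f)"
    using group_continuous[OF f] by (simp add: continuous_on_eq_continuous_at)
  then obtain \<delta> where \<delta>: "0 < \<delta>" and near: "\<And>s. \<bar>s\<bar> < \<delta> \<Longrightarrow> norm (G s f - f) < e / 2"
    using e f unfolding continuous_at_eps_delta
    by (metis diff_zero dist_norm group_0 half_gt_zero real_norm_def)
  obtain b where b: "(\<lambda>s. complex_of_real (b s)) \<in> test_functions UNIV" "\<And>s. 0 \<le> b s"
    "\<And>s. \<delta> \<le> \<bar>s\<bar> \<Longrightarrow> b s = 0" "(b has_integral 1) {-\<delta>..\<delta>}"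
    using approximate_identity_exists[OF \<delta>] by blast
  let ?\<phi> = "\<lambda>s. complex_of_real (b s)"
  have "((\<lambda>s. ?\<phi> s *\<^sub>C G s f) has_integral smeared G ?\<phi> f) {-\<delta>..\<delta>}"
    using b(3) by (intro smeared_has_integral[OF f] test_function_continuous[OF b(1)]) auto
  from has_integral_diff[OF this has_integral_scaleR_left[OF b(4), of f]]
  have i: "((\<lambda>s. b s *\<^sub>R (G s f - f)) has_integral smeared G ?\<phi> f - f) {-\<delta>..\<delta>}"
    by (simp add: scaleR_eq_scaleC scaleC_diff_right)
  have j: "((\<lambda>s. b s * (e / 2)) has_integral e / 2) {-\<delta>..\<delta>}"
    using has_integral_mult_left[OF b(4), of "e / 2"] by simp
  have "norm (integral {-\<delta>..\<delta>} (\<lambda>s. b s *\<^sub>R (G s f - f))) \<le> integral {-\<delta>..\<delta>} (\<lambda>s. b s * (e / 2))"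
  proof (rule Henstock_Kurzweil_Integration.integral_norm_bound_integral)
    fix s
    show "norm (b s *\<^sub>R (G s f - f)) \<le> b s * (e / 2)"
    proof (cases "\<bar>s\<bar> < \<delta>")
      case True
      then show ?thesis
        using mult_left_mono[OF less_imp_le[OF near[OF True]] b(2)[of s]] b(2)[of s] by simp
    qed (simp add: b(3))
  qed (use i j in \<open>auto simp: has_integral_integrable\<close>)
  then have "norm (smeared G ?\<phi> f - f) \<le> e / 2"
    unfolding integral_unique[OF i] integral_unique[OF j] .
  then have "dist (smeared G ?\<phi> f) f < e"
    using e by (simp add: dist_norm)
  with b(1) that show ?thesis
    by blast
qed

definition smeared_span :: "'a set" where
  "smeared_span = cspan {smeared G \<phi> f | \<phi> f. \<phi> \<in> test_functions UNIV \<and> f \<in> H}"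

lemma csubspace_smeared_span: "csubspace smeared_span"
  unfolding smeared_span_def cspan_def by (rule hull_in) (auto simp: csubspace_def)

lemma smeared_in_span: "\<phi> \<in> test_functions UNIV \<Longrightarrow> f \<in> H \<Longrightarrow> smeared G \<phi> f \<in> smeared_span"
  unfolding smeared_span_def cspan_def by (rule hull_inc) auto

lemma smeared_span_subset:
  assumes "csubspace V" "\<And>\<phi> f. \<phi> \<in> test_functions UNIV \<Longrightarrow> f \<in> H \<Longrightarrow> smeared G \<phi> f \<in> V"
  shows "smeared_span \<subseteq> V"
  unfolding smeared_span_def cspan_def using assms by (intro hull_minimal) auto

lemma smeared_span_subset_H: "smeared_span \<subseteq> H"
  by (intro smeared_span_subset csubspace smeared_in_H)

lemma smeared_span_dense: "dense_in H smeared_span"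
  unfolding dense_in_def
proof
  show "H \<subseteq> closure smeared_span"
  proof
    fix f assume f: "f \<in> H"
    show "f \<in> closure smeared_span"
      unfolding closure_approachable using smeared_approximates[OF f] smeared_in_span[OF _ f] by metis
  qed
qed (rule smeared_span_subset_H)

lemma smeared_span_invariant: "x \<in> smeared_span \<Longrightarrow> G t x \<in> smeared_span"
proof -
  have "smeared_span \<subseteq> {x \<in> H. G t x \<in> smeared_span}"
  proof (rule smeared_span_subset)
    show "csubspace {x \<in> H. G t x \<in> smeared_span}"
      using csubspace csubspace_smeared_span by (auto simp: csubspace_def lin)
  qed (simp add: group_smeared smeared_in_H smeared_in_span test_function_shift)
  then show "x \<in> smeared_span \<Longrightarrow> G t x \<in> smeared_span"
    by blast
qed

text \<open>The derivative at \<open>0\<close> of the orbit of a smeared vector is again smeared, with weight \<open>-\<phi>'\<close>, so the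
  derivatives stay in the span.\<close>

lemma smeared_span_differentiable:
  assumes "x \<in> smeared_span"
  obtains x' where "x' \<in> smeared_span" "\<And>t. ((\<lambda>t. G t x) has_vector_derivative G t x') (at t)"
proof -
  let ?V = "{x \<in> H. \<exists>x'\<in>smeared_span. ((\<lambda>t. G t x) has_vector_derivative x') (at 0)}"
  note D = csubspace_smeared_span
  have "smeared_span \<subseteq> ?V"
  proof (rule smeared_span_subset)
    have "\<exists>x'\<in>smeared_span. ((\<lambda>t. G t (x + y)) has_vector_derivative x') (at 0)"
      if xy: "x \<in> ?V" "y \<in> ?V" for x y
    proof -
      obtain x' y' where "x' \<in> smeared_span" "((\<lambda>t. G t x) has_vector_derivative x') (at 0)"
        "y' \<in> smeared_span" "((\<lambda>t. G t y) has_vector_derivative y') (at 0)"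
        using xy by blast
      then show ?thesis
        using xy has_vector_derivative_add csubspace_add[OF D]
        by (intro bexI[of _ "x' + y'"]) (auto simp: lin)
    qed
    moreover have "\<exists>x'\<in>smeared_span. ((\<lambda>t. G t (a *\<^sub>C x)) has_vector_derivative x') (at 0)"
      if x: "x \<in> ?V" for x a
    proof -
      obtain x' where x': "x' \<in> smeared_span" "((\<lambda>t. G t x) has_vector_derivative x') (at 0)"
        using x by blast
      from has_vector_derivative_scaleC[OF has_vector_derivative_const x'(2), of a]
      show ?thesis
        using x csubspace_scaleC[OF D x'(1)]
        by (intro bexI[of _ "a *\<^sub>C x'"]) (auto simp: lin)
    qed
    moreover have "0 \<in> ?V"
      using csubspace_0[OF D] csubspace_0[OF csubspace] by (auto simp: lin intro!: bexI[of _ 0])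
    ultimately show "csubspace ?V"
      using csubspace by (auto simp: csubspace_def)
    fix \<phi> :: "real \<Rightarrow> complex" and f
    assume \<phi>: "\<phi> \<in> test_functions UNIV" and f: "f \<in> H"
    obtain \<phi>' where \<phi>': "\<phi>' \<in> test_functions UNIV" "\<And>s. (\<phi> has_vector_derivative \<phi>' s) (at s)"
      using test_function_real_derivative[OF \<phi>] by blast
    show "smeared G \<phi> f \<in> ?V"
      using smeared_in_H[OF f \<phi>] smeared_has_vector_derivative[OF f \<phi> \<phi>']
        csubspace_minus[OF D smeared_in_span[OF \<phi>'(1) f]] by blast
  qed
  then obtain x' where "x' \<in> smeared_span" "((\<lambda>t. G t x) has_vector_derivative x') (at 0)"
    using assms by blast
  with that has_vector_derivative_at_0_imp assms smeared_span_subset_H show ?thesis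
    by blast
qed

end

section \<open>Spectral measures and the generator of a unitary group\<close>

lemma sets_spectral_measure_at [measurable_cong]: "sets (spectral_measure_at E x) = sets borel"
  using sets.sigma_sets_eq[of "borel :: real measure"]
  by (simp add: spectral_measure_at_def)

lemma space_spectral_measure_at [simp]: "space (spectral_measure_at E x) = UNIV"
  by (simp add: spectral_measure_at_def)

lemma projection_valued_measureD:
  assumes "projection_valued_measure H E" "x \<in> H"
  shows "B \<in> sets borel \<Longrightarrow> E B x \<in> H" "B \<in> sets borel \<Longrightarrow> E B (E B x) = E B x"
    "B \<in> sets borel \<Longrightarrow> y \<in> H \<Longrightarrow> cinner (E B x) y = cinner x (E B y)" "E UNIV x = x"
    "range C \<subseteq> sets borel \<Longrightarrow> disjoint_family C \<Longrightarrow> (\<lambda>n::nat. E (C n) x) sums E (\<Union>n. C n) x"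
  using assms by (simp_all add: projection_valued_measure_def clinear_from_to_def image_subset_iff)

context
  fixes H :: "'a::complex_inner set" and E :: "real set \<Rightarrow> 'a \<Rightarrow> 'a" and x :: 'a
  assumes E: "projection_valued_measure H E" and x: "x \<in> H"
begin

lemma projection_quadratic_form:
  assumes B: "B \<in> sets borel"
  shows "cinner (E B x) x = of_real ((norm (E B x))\<^sup>2)"
proof -
  note P = projection_valued_measureD[OF E]
  have "cinner (E B x) x = cinner (E B x) (E B x)"
    using P(3)[OF P(1)[OF x B] B x] P(2)[OF x B] by simp
  then show ?thesis
    by (simp only: cinner_self)
qed

lemma projection_sums:
  assumes "range B \<subseteq> sets borel" "disjoint_family B"
  shows "(\<lambda>n. Re (cinner (E (B n) x) x)) sums Re (cinner (E (\<Union>n. B n) x) x)"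
proof -
  have "(\<lambda>n. E (B n) x) sums E (\<Union>n. B n) x"
    by (rule projection_valued_measureD(5)[OF E x assms])
  then have "(\<lambda>n. cinner (E (B n) x) x) sums cinner (E (\<Union>n. B n) x) x"
    by (rule bounded_linear.sums[OF bounded_bilinear.bounded_linear_left[OF bounded_bilinear_cinner]])
  then show ?thesis
    by (rule sums_Re)
qed

text \<open>A term built by \<^const>\<open>measure_of\<close> carries the prescribed values only if they are countably additive;
  this comes from the strong additivity of \<open>E\<close> and \<open>\<langle>E(B)x, x\<rangle> = \<parallel>E(B)x\<parallel>\<^sup>2 \<ge> 0\<close>.\<close>

lemma emeasure_spectral_measure_at:
  assumes B: "B \<in> sets borel"
  shows "emeasure (spectral_measure_at E x) B = ennreal (Re (cinner (E B x) x))"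
  unfolding spectral_measure_at_def
proof (rule emeasure_measure_of_sigma)
  show "sigma_algebra UNIV (sets (borel :: real measure))"
    using sets.sigma_algebra_axioms[of "borel :: real measure"] by simp
  have "(\<lambda>n::nat. Re (cinner (E {} x) x)) sums Re (cinner (E {} x) x)"
    using projection_sums[of "\<lambda>_. {}"] by (simp add: disjoint_family_on_def)
  then have "(\<lambda>n::nat. Re (cinner (E {} x) x)) \<longlonglongrightarrow> 0"
    using summable_LIMSEQ_zero sums_summable by blast
  then have "Re (cinner (E {} x) x) = 0"
    by (simp add: LIMSEQ_const_iff)
  then show "positive (sets borel) (\<lambda>B. ennreal (Re (cinner (E B x) x)))"
    by (simp add: positive_def)
  show "countably_additive (sets borel) (\<lambda>B. ennreal (Re (cinner (E B x) x)))"
    unfolding countably_additive_def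
    by (intro allI impI suminf_ennreal_eq projection_sums)
      (auto simp: projection_quadratic_form simp del: of_real_power)
qed (rule B)

lemma emeasure_spectral_measure_at_UNIV:
  "emeasure (spectral_measure_at E x) UNIV = ennreal ((norm x)\<^sup>2)"
proof -
  note projection_valued_measureD(4)[OF E x]
  then show ?thesis
    by (simp add: emeasure_spectral_measure_at cinner_self del: of_real_power)
qed

lemma finite_spectral_measure_at: "finite_measure (spectral_measure_at E x)"
  by (rule finite_measureI) (simp add: emeasure_spectral_measure_at_UNIV)

lemma measure_spectral_measure_at_UNIV:
  "measure (spectral_measure_at E x) UNIV = (norm x)\<^sup>2"
  by (simp add: measure_def emeasure_spectral_measure_at_UNIV)

lemma integrable_exp_spectral_measure_at:
  "integrable (spectral_measure_at E x) (\<lambda>l. exp (\<i> * of_real (t * l)))"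
proof (rule finite_measure.integrable_const_bound[OF finite_spectral_measure_at, where B = 1])
  have "(\<lambda>l::real. exp (\<i> * complex_of_real (t * l))) \<in> borel_measurable borel"
    by (intro borel_measurable_continuous_onI continuous_intros)
  then show "(\<lambda>l. exp (\<i> * of_real (t * l))) \<in> borel_measurable (spectral_measure_at E x)"
    by measurable
qed simp

end

lemma exp_difference_quotient_LIMSEQ:
  assumes "h \<longlonglongrightarrow> 0" "\<And>n. h n \<noteq> (0::real)"
  shows "(\<lambda>n. (1 / h n) *\<^sub>R (exp (\<i> * of_real (h n * l)) - 1)) \<longlonglongrightarrow> \<i> * of_real l"
proof -
  have "((\<lambda>t. t *\<^sub>R (\<i> * complex_of_real l)) has_vector_derivative \<i> * of_real l) (at 0)"
    by (auto intro!: derivative_eq_intros)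
  from field_vector_diff_chain_at[OF this DERIV_exp]
  have "((\<lambda>t. exp (\<i> * of_real (t * l))) has_vector_derivative \<i> * of_real l) (at 0)"
    by (simp add: o_def scaleR_conv_of_real mult_ac)
  then have "((\<lambda>t. (1 / t) *\<^sub>R (exp (\<i> * of_real (t * l)) - 1)) \<longlongrightarrow> \<i> * of_real l) (at 0)"
    by (simp add: has_vector_derivative_iff_quotient)
  then show ?thesis
    by (rule filterlim_compose) (use assms in \<open>auto simp: filterlim_at\<close>)
qed

lemma exp_difference_quotient_bound:
  "norm ((1 / h) *\<^sub>R (exp (\<i> * of_real (h * l)) - 1)) \<le> \<bar>l\<bar>"
proof (cases "h = 0")
  case False
  have "norm (exp (\<i> * of_real (h * l)) - 1) = 2 * \<bar>sin (h * l / 2)\<bar>"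
    using dist_exp_i_1[of "h * l"] by simp
  also have "\<dots> \<le> \<bar>h\<bar> * \<bar>l\<bar>"
    using abs_sin_x_le_abs_x[of "h * l / 2"] by (simp add: abs_mult)
  finally show ?thesis
    using False by (simp only: norm_scaleR) (simp add: field_simps)
qed simp

locale exp_group =
  fixes H V :: "'a::complex_inner set" and S :: "'a \<Rightarrow> 'a" and U :: "real \<Rightarrow> 'a \<Rightarrow> 'a"
    and E :: "real set \<Rightarrow> 'a \<Rightarrow> 'a"
  assumes res: "spectral_resolution H V S E"
    and exp: "\<And>t. spectral_integral H E (\<lambda>l. exp (\<i> * of_real (t * l))) (U t)"
    and unitary: "\<And>t. unitary_op H (U t)"
begin

lemma pvm: "projection_valued_measure H E"
  using res by (simp add: spectral_resolution_def)

lemma cinner_group: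
  "x \<in> H \<Longrightarrow> cinner (U t x) x = (\<integral>l. exp (\<i> * of_real (t * l)) \<partial>spectral_measure_at E x)"
  using exp[of t] by (simp add: spectral_integral_def)

lemma norm_group: "x \<in> H \<Longrightarrow> norm (U t x) = norm x"
proof -
  assume "x \<in> H"
  then have "cinner (U t x) (U t x) = cinner x x"
    using unitary by (simp add: unitary_op_def)
  then show ?thesis
    unfolding cinner_self of_real_eq_iff by simp
qed

text \<open>\<open>\<parallel>U(t)x - x\<parallel>\<^sup>2 = 2\<parallel>x\<parallel>\<^sup>2 - 2 Re \<langle>U(t)x, x\<rangle>\<close> for an isometry, which the spectral integral turns into
  the integral of \<open>2 - 2 cos(tl) = |exp(\<i>tl) - 1|\<^sup>2\<close>.\<close>

lemma group_difference_norm: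
  assumes x: "x \<in> H"
  shows "(\<integral>\<^sup>+l. ennreal ((cmod ((1 / t) *\<^sub>R (exp (\<i> * of_real (t * l)) - 1)))\<^sup>2) \<partial>spectral_measure_at E x)
    = ennreal ((norm ((1 / t) *\<^sub>R (U t x - x)))\<^sup>2)"
proof -
  let ?M = "spectral_measure_at E x"
  interpret finite_measure ?M
    by (rule finite_spectral_measure_at[OF pvm x])
  have 1: "(cmod (z - 1))\<^sup>2 = 2 - 2 * Re z" if "cmod z = 1" for z
    using that cmod_power2[of z] cmod_power2[of "z - 1"]
    by (simp add: power2_eq_square algebra_simps)
  have int: "integrable ?M (\<lambda>l. Re (exp (\<i> * of_real (t * l))))"
    by (intro integrable_Re integrable_exp_spectral_measure_at[OF pvm x])
  have 2: "(cmod ((1 / t) *\<^sub>R (exp (\<i> * of_real (t * l)) - 1)))\<^sup>2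
      = (1 / t\<^sup>2) * (2 - 2 * Re (exp (\<i> * of_real (t * l))))" for l
    using 1[of "exp (\<i> * of_real (t * l))"]
    by (simp add: power_mult_distrib power_divide del: exp_of_real)
  have "(norm (U t x - x))\<^sup>2 = 2 * (norm x)\<^sup>2 - 2 * Re (cinner (U t x) x)"
    using norm_group[OF x, of t] dot_norm_neg[of "U t x" x] by (simp add: inner_eq_Re_cinner)
  also have "\<dots> = (\<integral>l. 2 - 2 * Re (exp (\<i> * of_real (t * l))) \<partial>?M)"
    unfolding cinner_group[OF x] integral_Re[OF integrable_exp_spectral_measure_at[OF pvm x], symmetric]
    using int by (simp add: measure_spectral_measure_at_UNIV[OF pvm x] mult.commute)
  finally have "(norm (U t x - x))\<^sup>2 = (\<integral>l. 2 - 2 * Re (exp (\<i> * of_real (t * l))) \<partial>?M)" .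
  then have 3: "(norm ((1 / t) *\<^sub>R (U t x - x)))\<^sup>2
      = (\<integral>l. (cmod ((1 / t) *\<^sub>R (exp (\<i> * of_real (t * l)) - 1)))\<^sup>2 \<partial>?M)"
    unfolding 2 by (simp add: power_mult_distrib power_divide)
  have "integrable ?M (\<lambda>l. (cmod ((1 / t) *\<^sub>R (exp (\<i> * of_real (t * l)) - 1)))\<^sup>2)"
    unfolding 2 using int by simp
  then show ?thesis
    unfolding 3 by (intro nn_integral_eq_integral) auto
qed

text \<open>By Fatou's lemma \<open>\<integral>\<lambda>\<^sup>2 dE\<^sub>x\<close> is at most the limit of the squared norms of the difference
  quotients, so differentiability at \<open>0\<close> puts \<open>x\<close> into the domain.\<close>

lemma differentiable_imp_in_domain:
  assumes x: "x \<in> H" and 0: "U 0 x = x" and d: "((\<lambda>t. U t x) has_vector_derivative x') (at 0)"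
  shows "x \<in> V"
proof -
  let ?M = "spectral_measure_at E x"
  define h where "h n = 1 / real (Suc n)" for n
  have h: "h \<longlonglongrightarrow> 0" "h n \<noteq> 0" for n
    using LIMSEQ_inverse_real_of_nat by (simp_all add: h_def[abs_def] inverse_eq_divide)
  have "((\<lambda>t. (1 / t) *\<^sub>R (U t x - x)) \<longlongrightarrow> x') (at 0)"
    using d by (simp add: has_vector_derivative_iff_quotient 0)
  then have "(\<lambda>n. (1 / h n) *\<^sub>R (U (h n) x - x)) \<longlonglongrightarrow> x'"
    by (rule filterlim_compose) (use h in \<open>auto simp: filterlim_at\<close>)
  then have lim: "(\<lambda>n. ennreal ((norm ((1 / h n) *\<^sub>R (U (h n) x - x)))\<^sup>2)) \<longlonglongrightarrow> ennreal ((norm x')\<^sup>2)"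
    by (intro tendsto_intros)
  have "(\<integral>\<^sup>+l. ennreal (l\<^sup>2) \<partial>?M)
      = (\<integral>\<^sup>+l. liminf (\<lambda>n. ennreal ((cmod ((1 / h n) *\<^sub>R (exp (\<i> * of_real (h n * l)) - 1)))\<^sup>2)) \<partial>?M)"
  proof (rule nn_integral_cong)
    fix l
    have "(\<lambda>n. ennreal ((cmod ((1 / h n) *\<^sub>R (exp (\<i> * of_real (h n * l)) - 1)))\<^sup>2))
        \<longlonglongrightarrow> ennreal ((cmod (\<i> * of_real l))\<^sup>2)"
      by (intro tendsto_intros exp_difference_quotient_LIMSEQ h)
    from lim_imp_Liminf[OF _ this]
    show "ennreal (l\<^sup>2) = liminf (\<lambda>n. ennreal ((cmod ((1 / h n) *\<^sub>R (exp (\<i> * of_real (h n * l)) - 1)))\<^sup>2))"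
      by (simp add: norm_mult)
  qed
  also have "\<dots> \<le> liminf (\<lambda>n. \<integral>\<^sup>+l. ennreal ((cmod ((1 / h n) *\<^sub>R (exp (\<i> * of_real (h n * l)) - 1)))\<^sup>2) \<partial>?M)"
  proof (rule nn_integral_liminf)
    have "(\<lambda>l::real. (cmod ((1 / h n) *\<^sub>R (exp (\<i> * of_real (h n * l)) - 1)))\<^sup>2) \<in> borel_measurable borel" for n
      by (intro borel_measurable_continuous_onI continuous_intros)
    then show "(\<lambda>l. ennreal ((cmod ((1 / h n) *\<^sub>R (exp (\<i> * of_real (h n * l)) - 1)))\<^sup>2)) \<in> borel_measurable ?M" for n
      by measurable
  qed
  also have "\<dots> = ennreal ((norm x')\<^sup>2)"
    unfolding group_difference_norm[OF x] by (rule lim_imp_Liminf[OF _ lim]) simp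
  finally have "(\<integral>\<^sup>+l. ennreal (l\<^sup>2) \<partial>?M) < \<infinity>"
    by (simp add: le_less_trans[OF _ ennreal_less_top])
  then have "integrable ?M (\<lambda>l. l\<^sup>2)"
    by (intro integrableI_nonneg) auto
  then show ?thesis
    using res x by (simp add: spectral_resolution_def)
qed

text \<open>On the domain \<open>|l|\<close> is integrable and dominates the difference quotients of \<open>exp(\<i>tl)\<close>.\<close>

lemma derivative_quadratic_form:
  assumes x: "x \<in> V" and 0: "U 0 x = x" and d: "((\<lambda>t. U t x) has_vector_derivative x') (at 0)"
  shows "cinner x' x = \<i> * cinner (S x) x"
proof -
  let ?M = "spectral_measure_at E x"
  have xH: "x \<in> H" and sq: "integrable ?M (\<lambda>l. l\<^sup>2)"
    and S: "cinner (S x) x = of_real (\<integral>l. l \<partial>?M)"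
    using res x by (auto simp: spectral_resolution_def)
  define h where "h n = 1 / real (Suc n)" for n
  have h: "h \<longlonglongrightarrow> 0" "h n \<noteq> 0" for n
    using LIMSEQ_inverse_real_of_nat by (simp_all add: h_def[abs_def] inverse_eq_divide)
  interpret finite_measure ?M
    by (rule finite_spectral_measure_at[OF pvm xH])
  have "((\<lambda>t. (1 / t) *\<^sub>R (U t x - x)) \<longlongrightarrow> x') (at 0)"
    using d by (simp add: has_vector_derivative_iff_quotient 0)
  then have "(\<lambda>n. (1 / h n) *\<^sub>R (U (h n) x - x)) \<longlonglongrightarrow> x'"
    by (rule filterlim_compose) (use h in \<open>auto simp: filterlim_at\<close>)
  then have lim1: "(\<lambda>n. cinner ((1 / h n) *\<^sub>R (U (h n) x - x)) x) \<longlonglongrightarrow> cinner x' x"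
    by (intro tendsto_intros)
  have eq: "cinner ((1 / h n) *\<^sub>R (U (h n) x - x)) x
      = (\<integral>l. (1 / h n) *\<^sub>R (exp (\<i> * of_real (h n * l)) - 1) \<partial>?M)" for n
  proof -
    have "cinner (U (h n) x - x) x = (\<integral>l. exp (\<i> * of_real (h n * l)) - 1 \<partial>?M)"
      using integrable_exp_spectral_measure_at[OF pvm xH, of "h n"]
      by (simp add: cinner_diff_left cinner_group[OF xH] cinner_self
          measure_spectral_measure_at_UNIV[OF pvm xH] scaleR_conv_of_real)
    then show ?thesis
      by (simp add: cinner_scaleR_left)
  qed
  have lin: "integrable ?M (\<lambda>l. \<bar>l\<bar>)"
  proof (rule Bochner_Integration.integrable_bound)
    show "integrable ?M (\<lambda>l. 1 + l\<^sup>2)"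
      using sq by simp
    show "AE l in ?M. norm \<bar>l\<bar> \<le> norm (1 + l\<^sup>2)"
    proof (intro AE_I2)
      fix l :: real
      have "2 * \<bar>l\<bar> \<le> 1 + l\<^sup>2"
        using sum_squares_bound[of 1 "\<bar>l\<bar>"] by simp
      then show "norm \<bar>l\<bar> \<le> norm (1 + l\<^sup>2)"
        by simp
    qed
  qed measurable
  have "(\<lambda>n. \<integral>l. (1 / h n) *\<^sub>R (exp (\<i> * of_real (h n * l)) - 1) \<partial>?M) \<longlonglongrightarrow> (\<integral>l. \<i> * of_real l \<partial>?M)"
  proof (rule integral_dominated_convergence[OF _ _ lin])
    have "(\<lambda>l::real. (1 / h n) *\<^sub>R (exp (\<i> * of_real (h n * l)) - 1)) \<in> borel_measurable borel" for n
      by (intro borel_measurable_continuous_onI continuous_intros)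
    then show "(\<lambda>l. (1 / h n) *\<^sub>R (exp (\<i> * of_real (h n * l)) - 1)) \<in> borel_measurable ?M" for n
      by measurable
    have "(\<lambda>l::real. \<i> * complex_of_real l) \<in> borel_measurable borel"
      by (intro borel_measurable_continuous_onI continuous_intros)
    then show "(\<lambda>l. \<i> * complex_of_real l) \<in> borel_measurable ?M"
      by measurable
    show "AE l in ?M. (\<lambda>n. (1 / h n) *\<^sub>R (exp (\<i> * of_real (h n * l)) - 1)) \<longlonglongrightarrow> \<i> * of_real l"
      by (intro AE_I2 exp_difference_quotient_LIMSEQ h)
    show "AE l in ?M. norm ((1 / h n) *\<^sub>R (exp (\<i> * of_real (h n * l)) - 1)) \<le> \<bar>l\<bar>" for n
      by (intro AE_I2 exp_difference_quotient_bound)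
  qed
  then have "(\<lambda>n. cinner ((1 / h n) *\<^sub>R (U (h n) x - x)) x) \<longlonglongrightarrow> \<i> * cinner (S x) x"
    by (simp add: eq S)
  with lim1 show ?thesis
    by (rule LIMSEQ_unique)
qed

text \<open>The quadratic forms of the derivative and of \<open>iS\<close> agree on \<open>W\<close>; polarization and density
  of \<open>W\<close> make the operators agree.\<close>

lemma generator_on_dense_subspace:
  assumes S: "clinear_from_to V H S" and W: "dense_in H W" and T: "clinear_from_to W H T"
    and 0: "\<And>x. x \<in> W \<Longrightarrow> U 0 x = x"
    and d: "\<And>x. x \<in> W \<Longrightarrow> ((\<lambda>t. U t x) has_vector_derivative T x) (at 0)"
    and x: "x \<in> W"
  shows "x \<in> V" "\<i> *\<^sub>C S x = T x"
proof -
  have WV: "w \<in> V" if "w \<in> W" for w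
    using W that by (intro differentiable_imp_in_domain[OF _ 0 d]) (auto simp: dense_in_def)
  show "x \<in> V"
    using WV[OF x] .
  note lT = clinear_from_toD[OF T] and lS = clinear_from_toD[OF S]
  have "clinear_from_to W UNIV T" "clinear_from_to W UNIV (\<lambda>w. \<i> *\<^sub>C S w)"
    using lT(1) WV by (auto simp: clinear_from_to_def lT lS scaleC_add_right scaleC_scaleC mult.commute)
  then have "cinner (T x) w = cinner (\<i> *\<^sub>C S x) w" if "w \<in> W" for w
    by (rule quadratic_form_eq_imp_form_eq[OF _ _ _ x that])
      (simp add: derivative_quadratic_form[OF WV 0 d] cinner_scaleC_left)
  then have "cinner w (\<i> *\<^sub>C S x - T x) = 0" if "w \<in> W" for w
    using that by (subst cinner_eq_0_commute) (simp add: cinner_diff_left)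
  moreover have "\<i> *\<^sub>C S x - T x \<in> H"
    using lT(2)[OF x] lS(2)[OF WV[OF x]] exp[of 0] clinear_from_toD(1)[OF bounded_op_clinear]
    by (metis csubspace_diff csubspace_scaleC spectral_integral_def)
  ultimately have "\<i> *\<^sub>C S x - T x = 0"
    by (intro dense_orthogonal_imp_0[OF W])
  then show "\<i> *\<^sub>C S x = T x"
    by simp
qed

end

section \<open>A differentiable invariant subspace is a core\<close>

text \<open>The solutions are \<open>exp(\<sigma>t) c\<close>, unbounded in one of the two directions unless \<open>c = 0\<close>.\<close>

lemma bounded_solution_of_linear_ode_eq_0:
  fixes h :: "real \<Rightarrow> 'a::real_normed_vector"
  assumes \<sigma>: "\<sigma> \<noteq> 0" and d: "\<And>t. (h has_vector_derivative \<sigma> *\<^sub>R h t) (at t)"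
    and M: "\<And>t. norm (h t) \<le> M"
  shows "h t = 0"
proof -
  have "((\<lambda>t. exp (- \<sigma> * t) *\<^sub>R h t) has_vector_derivative 0) (at t)" for t
  proof -
    have "((\<lambda>t. exp (- \<sigma> * t)) has_real_derivative - \<sigma> * exp (- \<sigma> * t)) (at t)"
      by (auto intro!: derivative_eq_intros)
    from has_vector_derivative_scaleR[OF this d] show ?thesis
      by (simp add: mult.commute)
  qed
  then obtain c where c: "\<And>t. exp (- \<sigma> * t) *\<^sub>R h t = c"
    using has_vector_derivative_zero_constant[of UNIV "\<lambda>t. exp (- \<sigma> * t) *\<^sub>R h t"] by auto
  have h: "h t = exp (\<sigma> * t) *\<^sub>R c" for t
    by (simp add: c[of t, symmetric] flip: exp_add)
  have "c = 0"
  proof (rule ccontr)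
    assume "c \<noteq> 0"
    then have "exp s \<le> M / norm c" for s
      using M[of "s / \<sigma>"] \<sigma> by (simp add: h field_simps)
    then have "1 + M / norm c \<le> M / norm c"
      using exp_ge_add_one_self[of "M / norm c"] order_trans by blast
    then show False
      by simp
  qed
  then show ?thesis
    by (simp add: h)
qed

text \<open>\<open>g'' = g\<close> factors: \<open>g + g'\<close> and \<open>g - g'\<close> are bounded solutions of \<open>h' = h\<close> and \<open>h' = -h\<close>.\<close>

lemma bounded_solution_of_second_order_ode_eq_0:
  fixes g g' :: "real \<Rightarrow> 'a::real_normed_vector"
  assumes g: "\<And>t. (g has_vector_derivative g' t) (at t)"
    and g': "\<And>t. (g' has_vector_derivative g t) (at t)"
    and M: "\<And>t. norm (g t) \<le> M" "\<And>t. norm (g' t) \<le> M"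
  shows "g t = 0"
proof -
  have "g t + g' t = 0"
  proof (rule bounded_solution_of_linear_ode_eq_0[of 1 "\<lambda>t. g t + g' t" "M + M"])
    show "norm (g t + g' t) \<le> M + M" for t
      by (intro norm_triangle_mono M)
    show "((\<lambda>t. g t + g' t) has_vector_derivative 1 *\<^sub>R (g t + g' t)) (at t)" for t
      using has_vector_derivative_add[OF g g'] by (simp add: add.commute)
  qed simp
  moreover have "g t - g' t = 0"
  proof (rule bounded_solution_of_linear_ode_eq_0[of "-1" "\<lambda>t. g t - g' t" "M + M"])
    show "norm (g t - g' t) \<le> M + M" for t
      using norm_triangle_ineq4[of "g t" "g' t"] M[of t] by linarith
    show "((\<lambda>t. g t - g' t) has_vector_derivative (-1) *\<^sub>R (g t - g' t)) (at t)" for t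
      using has_vector_derivative_diff[OF g g'] by simp
  qed simp
  ultimately have "(2::real) *\<^sub>R g t = 0"
    by (simp add: scaleR_2)
  then show ?thesis
    by simp
qed

lemma selfadjoint_op_symmetric:
  assumes S: "selfadjoint_op H V S" and "u \<in> V" "y \<in> V"
  shows "cinner (S u) y = cinner u (S y)"
proof -
  have "(y, S y) \<in> adjoint_graph H V S"
    using assms by (auto simp: selfadjoint_op_def op_graph_def)
  with \<open>u \<in> V\<close> show ?thesis
    by (simp add: adjoint_graph_def)
qed

lemma closed_adjoint_graph:
  assumes "closed H"
  shows "closed (adjoint_graph H V S)"
proof -
  have "adjoint_graph H V S = (H \<times> H) \<inter> (\<Inter>x\<in>V. {p. cinner (S x) (fst p) = cinner x (snd p)})"
    by (auto simp: adjoint_graph_def)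
  also have "closed \<dots>"
    using assms by (intro closed_Int closed_Times closed_INT ballI closed_Collect_eq continuous_intros)
  finally show ?thesis .
qed

lemma csubspace_op_graph:
  assumes S: "clinear_from_to V H S" and W: "csubspace W" "W \<subseteq> V"
  shows "csubspace (op_graph W S)"
proof -
  note lin = clinear_from_toD[OF S]
  have "(x, S x) + (y, S y) \<in> op_graph W S" if "x \<in> W" "y \<in> W" for x y
    using csubspace_add[OF W(1) that] lin(3)[OF subsetD[OF W(2) that(1)] subsetD[OF W(2) that(2)]]
    by (auto simp: op_graph_def)
  moreover have "a *\<^sub>C (x, S x) \<in> op_graph W S" if "x \<in> W" for x a
    using csubspace_scaleC[OF W(1) that] lin(4)[OF subsetD[OF W(2) that]]
    by (auto simp: op_graph_def scaleC_prod_def)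
  moreover have "(0, 0) \<in> op_graph W S"
    using csubspace_0[OF W(1)] lin(6) by (auto simp: op_graph_def)
  ultimately show ?thesis
    by (auto simp: csubspace_def op_graph_def zero_prod_def)
qed

text \<open>A vector \<open>(y, Sy)\<close> of the graph orthogonal to the graph over \<open>W\<close> satisfies
  \<open>\<langle>x, y\<rangle> = - \<langle>S\<^sup>2x, y\<rangle>\<close> for \<open>x \<in> W\<close>. Along the orbit of \<open>x\<close>, which stays in \<open>W\<close>, this says that
  \<open>g(t) = \<langle>U(t)x, y\<rangle>\<close> solves \<open>g'' = g\<close>; being bounded, \<open>g\<close> vanishes. Hence \<open>y\<close> is orthogonal to
  the dense subspace \<open>W\<close>.\<close>

lemma differentiable_invariant_subspace_is_core:
  fixes H V W :: "'a::{complex_inner, banach} set"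
  assumes S: "selfadjoint_op H V S" and H: "closed H"
    and W: "csubspace W" "W \<subseteq> V" "dense_in H W"
    and U: "\<And>t. unitary_op H (U t)"
    and inv: "\<And>x. x \<in> W \<Longrightarrow> S x \<in> W" "\<And>t x. x \<in> W \<Longrightarrow> U t x \<in> W"
    and grp: "\<And>x. x \<in> W \<Longrightarrow> U 0 x = x" "\<And>s t x. x \<in> W \<Longrightarrow> U (t + s) x = U s (U t x)"
    and d: "\<And>x t. x \<in> W \<Longrightarrow> ((\<lambda>t. U t x) has_vector_derivative U t (\<i> *\<^sub>C S x)) (at t)"
  shows "is_core W V S"
proof -
  have lin: "clinear_from_to V H S" and graph: "adjoint_graph H V S = op_graph V S"
    using S by (auto simp: selfadjoint_op_def)
  have WH: "W \<subseteq> H" and VH: "V \<subseteq> H"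
    using W S by (auto simp: dense_in_def selfadjoint_op_def)
  have cl: "closed (op_graph V S)"
    using closed_adjoint_graph[OF H, of V S] by (simp add: graph)
  have sub: "op_graph W S \<subseteq> op_graph V S"
    using W(2) by (auto simp: op_graph_def)
  \<comment> \<open>Both sides are the derivative at \<open>0\<close> of the orbit of \<open>U(t)x\<close>.\<close>
  have comm: "U t (\<i> *\<^sub>C S x) = \<i> *\<^sub>C S (U t x)" if x: "x \<in> W" for t x
  proof -
    have "((\<lambda>s. U s (U t x)) has_vector_derivative U t (\<i> *\<^sub>C S x)) (at 0)"
      using d[OF x, of t] x inv
      by (simp add: has_vector_derivative_iff_quotient grp)
    moreover have "((\<lambda>s. U s (U t x)) has_vector_derivative \<i> *\<^sub>C S (U t x)) (at 0)"
      using d[OF inv(2)[OF x], of t 0] grp(1)[OF csubspace_scaleC[OF W(1) inv(1)[OF inv(2)[OF x]]]]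
      by simp
    ultimately show ?thesis
      by (rule vector_derivative_unique_at)
  qed
  have isoW: "norm (U t x) = norm x" if "x \<in> W" for t x
  proof -
    have "cinner (U t x) (U t x) = cinner x x"
      using U WH that by (auto simp: unitary_op_def)
    then show ?thesis
      unfolding cinner_self of_real_eq_iff by simp
  qed
  have "op_graph V S \<subseteq> closure (op_graph W S)"
  proof (rule closureI_orthogonal)
    show "csubspace (op_graph W S)" "csubspace (op_graph V S)"
      using csubspace_op_graph[OF lin] W clinear_from_toD(1)[OF lin] by auto
    fix p assume "p \<in> op_graph V S" and orth: "\<And>q. q \<in> op_graph W S \<Longrightarrow> cinner q p = 0"
    then obtain y where p: "p = (y, S y)" and y: "y \<in> V"
      by (auto simp: op_graph_def)
    have o: "cinner x y = - cinner (S (S x)) y" if x: "x \<in> W" for x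
    proof -
      have "cinner x y + cinner (S x) (S y) = 0"
        using orth[of "(x, S x)"] x by (auto simp: op_graph_def p cinner_prod_def)
      then show ?thesis
        using selfadjoint_op_symmetric[OF S _ y, of "S x"] inv(1)[OF x] W(2)
        by (simp add: eq_neg_iff_add_eq_0 subset_iff)
    qed
    have "cinner x y = 0" if x: "x \<in> W" for x
    proof -
      let ?x' = "\<i> *\<^sub>C S x"
      have x': "?x' \<in> W"
        by (intro csubspace_scaleC[OF W(1)] inv x)
      note dc = bounded_linear.has_vector_derivative[OF
          bounded_bilinear.bounded_linear_left[OF bounded_bilinear_cinner]]
      have "cinner (U 0 x) y = 0"
      proof (rule bounded_solution_of_second_order_ode_eq_0)
        show "((\<lambda>t. cinner (U t x) y) has_vector_derivative cinner (U t ?x') y) (at t)" for t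
          by (rule dc[OF d[OF x]])
        have "cinner (U t (\<i> *\<^sub>C S ?x')) y = cinner (U t x) y" for t
        proof -
          have "U t (\<i> *\<^sub>C S ?x') = \<i> *\<^sub>C S (\<i> *\<^sub>C S (U t x))"
            by (simp only: comm[OF x'] comm[OF x])
          also have "\<dots> = - S (S (U t x))"
            using clinear_from_toD(4)[OF lin subsetD[OF W(2) inv(1)[OF inv(2)[OF x]]]]
            by (simp add: scaleC_scaleC scaleC_minus_one)
          finally show ?thesis
            using o[OF inv(2)[OF x]] by (simp add: cinner_minus_left)
        qed
        then show "((\<lambda>t. cinner (U t ?x') y) has_vector_derivative cinner (U t x) y) (at t)" for t
          by (intro has_vector_derivative_eq_rhs[OF dc[OF d[OF x']]])
        show "norm (cinner (U t x) y) \<le> max (norm x) (norm ?x') * norm y" for t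
          using Cauchy_Schwarz_cinner[of "U t x" y]
          by (rule order_trans) (simp add: isoW[OF x] mult_right_mono)
        show "norm (cinner (U t ?x') y) \<le> max (norm x) (norm ?x') * norm y" for t
          using Cauchy_Schwarz_cinner[of "U t ?x'" y]
          by (rule order_trans) (simp add: isoW[OF x'] mult_right_mono)
      qed
      then show ?thesis
        by (simp add: grp(1)[OF x])
    qed
    then have "y = 0"
      using y VH by (intro dense_orthogonal_imp_0[OF W(3)]) auto
    then show "p = 0"
      using clinear_from_toD(6)[OF lin] by (simp add: p zero_prod_def)
  qed (use cl sub in \<open>auto\<close>)
  with closure_minimal[OF sub cl] W show ?thesis
    by (auto simp: is_core_def)
qed

section \<open>The unitary group intertwined with a group of bounded operators\<close>

context operator_group
begin

context
  fixes R S :: "'a \<Rightarrow> 'a" and U :: "real \<Rightarrow> 'a \<Rightarrow> 'a" and V :: "'a set"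
  assumes R: "bounded_op H R" "dense_in H (R ` H)"
    and U: "\<And>t. unitary_op H (U t)"
    and UR: "\<And>t f. f \<in> H \<Longrightarrow> U t (R f) = R (G t f)"
    and S: "selfadjoint_op H V S" "is_exp_i_group H V S U"
begin

lemma image_smeared_span_subset_H: "R ` smeared_span \<subseteq> H"
  using R(2) smeared_span_subset_H by (auto simp: dense_in_def)

lemma image_smeared_span_dense: "dense_in H (R ` smeared_span)"
  by (rule bounded_op_dense_image[OF R(1) smeared_span_dense R(2)])

lemma csubspace_image_smeared_span: "csubspace (R ` smeared_span)"
  by (rule clinear_image_csubspace[OF bounded_op_clinear[OF R(1)] csubspace_smeared_span
        smeared_span_subset_H])

lemma intertwined_orbit: "f \<in> smeared_span \<Longrightarrow> U t (R f) = R (G t f)"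
  using UR smeared_span_subset_H by blast

lemma image_smeared_span_invariant: "x \<in> R ` smeared_span \<Longrightarrow> U t x \<in> R ` smeared_span"
  by (auto simp: intertwined_orbit smeared_span_invariant)

lemma intertwined_group:
  assumes "x \<in> R ` smeared_span"
  shows "U 0 x = x" "U (t + s) x = U s (U t x)"
  using assms smeared_span_subset_H smeared_span_invariant
  by (auto simp: intertwined_orbit group_0 add.commute[of t] group_add subset_iff)

lemma intertwined_orbit_derivative:
  assumes f: "f \<in> smeared_span" and f': "f' \<in> smeared_span"
    and d: "((\<lambda>t. G t f) has_vector_derivative G t f') (at t)"
  shows "((\<lambda>t. U t (R f)) has_vector_derivative U t (R f')) (at t)"
proof -
  have "((\<lambda>t. R (G t f)) has_vector_derivative R (G t f')) (at t)"
    using f f' smeared_span_subset_H by (intro bounded_op_has_vector_derivative[OF R(1) _ _ d] in_H) auto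
  then show ?thesis
    using f f' by (simp add: intertwined_orbit)
qed

lemma image_smeared_span_differentiable:
  assumes "x \<in> R ` smeared_span"
  obtains x' where "x' \<in> R ` smeared_span" "\<And>t. ((\<lambda>t. U t x) has_vector_derivative U t x') (at t)"
proof -
  obtain f where f: "f \<in> smeared_span" "x = R f"
    using assms by blast
  obtain f' where f': "f' \<in> smeared_span" "\<And>t. ((\<lambda>t. G t f) has_vector_derivative G t f') (at t)"
    using smeared_span_differentiable[OF f(1)] by blast
  show ?thesis
    using that[OF imageI[OF f'(1)]] intertwined_orbit_derivative[OF f(1) f'] f(2) by blast
qed

lemma generator_on_image_smeared_span:
  assumes x: "x \<in> R ` smeared_span"
  shows "x \<in> V" "((\<lambda>t. U t x) has_vector_derivative \<i> *\<^sub>C S x) (at 0)"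
proof -
  let ?W = "R ` smeared_span" and ?T = "\<lambda>x. vector_derivative (\<lambda>t. U t x) (at 0)"
  note W = csubspace_image_smeared_span
  obtain E where "exp_group H V S U E"
    using S(2) U by (auto simp: is_exp_i_group_def exp_group_def)
  then interpret exp_group H V S U E .
  have T: "((\<lambda>t. U t y) has_vector_derivative ?T y) (at 0)" and TW: "?T y \<in> ?W" if y: "y \<in> ?W" for y
  proof -
    obtain y' where y': "y' \<in> ?W" "\<And>t. ((\<lambda>t. U t y) has_vector_derivative U t y') (at t)"
      by (rule image_smeared_span_differentiable[OF y], rule that)
    have d: "((\<lambda>t. U t y) has_vector_derivative y') (at 0)"
      using y'(2)[of 0] unfolding intertwined_group(1)[OF y'(1)] .
    show "((\<lambda>t. U t y) has_vector_derivative ?T y) (at 0)" "?T y \<in> ?W"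
      unfolding vector_derivative_at[OF d] by (rule d, rule y'(1))
  qed
  have UL: "clinear_from_to H H (U t)" for t
    using U by (simp add: unitary_op_def)
  have in_H: "y \<in> H" if "y \<in> ?W" for y
    using image_smeared_span_subset_H that by blast
  have add: "?T (y + z) = ?T y + ?T z" if "y \<in> ?W" "z \<in> ?W" for y z
  proof -
    have "((\<lambda>t. U t (y + z)) has_vector_derivative ?T y + ?T z) (at 0)"
      using has_vector_derivative_add[OF T[OF that(1)] T[OF that(2)]] in_H[OF that(1)] in_H[OF that(2)]
      by (simp add: clinear_from_toD(3)[OF UL])
    then show ?thesis
      by (rule vector_derivative_at)
  qed
  have scale: "?T (a *\<^sub>C y) = a *\<^sub>C ?T y" if "y \<in> ?W" for y a
  proof -
    have "((\<lambda>t. U t (a *\<^sub>C y)) has_vector_derivative a *\<^sub>C ?T y) (at 0)"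
      using has_vector_derivative_scaleC[OF has_vector_derivative_const T[OF that], of a] in_H[OF that]
      by (simp add: clinear_from_toD(4)[OF UL])
    then show ?thesis
      by (rule vector_derivative_at)
  qed
  have lin: "clinear_from_to ?W H ?T"
    unfolding clinear_from_to_def using W add scale TW in_H by blast
  have "clinear_from_to V H S"
    using S(1) by (simp add: selfadjoint_op_def)
  note gen = generator_on_dense_subspace[OF this image_smeared_span_dense lin intertwined_group(1) T x]
  show "x \<in> V"
    by (rule gen(1))
  show "((\<lambda>t. U t x) has_vector_derivative \<i> *\<^sub>C S x) (at 0)"
    using T[OF x] gen(2) by simp
qed

text \<open>Differentiating \<open>U(t)Rf = RG(t)f\<close> at \<open>0\<close> gives the first equation; invariance under \<open>S\<close> follows because
  the derivative of \<open>G(t)f\<close> is again in the smeared span.\<close>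

lemma generator_intertwined:
  assumes f: "f \<in> smeared_span"
  shows "\<i> *\<^sub>C S (R f) = R (vector_derivative (\<lambda>t. G t f) (at 0))"
    and "S (R f) \<in> R ` smeared_span"
proof -
  obtain f' where f': "f' \<in> smeared_span" "((\<lambda>t. G t f) has_vector_derivative G 0 f') (at 0)"
    using smeared_span_differentiable[OF f] by metis
  have "((\<lambda>t. U t (R f)) has_vector_derivative U 0 (R f')) (at 0)"
    by (rule intertwined_orbit_derivative[OF f f'])
  then have iS: "\<i> *\<^sub>C S (R f) = R f'"
    using vector_derivative_unique_at[OF generator_on_image_smeared_span(2)] f f'(1)
      intertwined_group(1) by (metis imageI)
  moreover have "vector_derivative (\<lambda>t. G t f) (at 0) = f'"
    using vector_derivative_at[OF f'(2)] f'(1) smeared_span_subset_H by (auto simp: group_0)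
  ultimately show "\<i> *\<^sub>C S (R f) = R (vector_derivative (\<lambda>t. G t f) (at 0))"
    by simp
  have "S (R f) = (- \<i>) *\<^sub>C (\<i> *\<^sub>C S (R f))"
    by (simp add: scaleC_scaleC)
  also have "\<dots> \<in> R ` smeared_span"
    unfolding iS by (intro csubspace_scaleC[OF csubspace_image_smeared_span] imageI f'(1))
  finally show "S (R f) \<in> R ` smeared_span" .
qed

lemma image_smeared_span_is_core: "is_core (R ` smeared_span) V S"
proof (rule differentiable_invariant_subspace_is_core[OF S(1) closed])
  show "((\<lambda>t. U t x) has_vector_derivative U t (\<i> *\<^sub>C S x)) (at t)"
    if x: "x \<in> R ` smeared_span" for x t
  proof -
    obtain x' where x': "x' \<in> R ` smeared_span"
      "\<And>t. ((\<lambda>t. U t x) has_vector_derivative U t x') (at t)"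
      using image_smeared_span_differentiable[OF x] by blast
    have "\<i> *\<^sub>C S x = x'"
      using vector_derivative_unique_at[OF generator_on_image_smeared_span(2)[OF x] x'(2)]
        intertwined_group(1)[OF x'(1)] by simp
    with x'(2) show ?thesis
      by simp
  qed
qed (use csubspace_image_smeared_span image_smeared_span_dense U generator_intertwined(2)
    generator_on_image_smeared_span(1) image_smeared_span_invariant intertwined_group in \<open>auto\<close>)

end

end

text \<open>\<open>\<langle>A y, y\<rangle>\<close> is the squared norm of \<open>y\<close> in L2, and \<open>A y\<close> lies in the range of the square root,
  so a vector orthogonal to this range vanishes in L2.\<close>

lemma positive_sqrt_dense_range:
  assumes A: "\<forall>f\<in>H10 \<Omega>. \<forall>g\<in>H10 \<Omega>. cinner (A f) g = L2_inner f g"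
    and R: "positive_sqrt (H10 \<Omega>) A R"
  shows "dense_in (H10 \<Omega>) (R ` H10 \<Omega>)"
  unfolding dense_in_def
proof
  have "bounded_op (H10 \<Omega>) R" and RR: "\<And>f. f \<in> H10 \<Omega> \<Longrightarrow> R (R f) = A f"
    using R by (auto simp: positive_sqrt_def positive_op_def)
  note lin = bounded_op_clinear[OF this(1)]
  show sub: "R ` H10 \<Omega> \<subseteq> H10 \<Omega>"
    using clinear_from_toD(2)[OF lin] by blast
  show "H10 \<Omega> \<subseteq> closure (R ` H10 \<Omega>)"
  proof (rule closureI_orthogonal)
    show "csubspace (R ` H10 \<Omega>)" "csubspace (H10 \<Omega>)"
      using clinear_from_toD(1)[OF lin] by (auto intro: clinear_image_csubspace[OF lin])
    show "closed (H10 \<Omega>)"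
      by (simp add: H10_def)
    fix y assume y: "y \<in> H10 \<Omega>" and orth: "\<And>x. x \<in> R ` H10 \<Omega> \<Longrightarrow> cinner x y = 0"
    have "L2_inner y y = cinner (R (R y)) y"
      using A y by (simp add: RR)
    also have "\<dots> = 0"
      using y sub by (intro orth) blast
    finally have "fst y = 0"
      by (simp add: L2_inner_def)
    then show "y = 0"
      by (rule H10_eq_0_if_fst_eq_0[OF y])
  qed (rule sub)
qed

section \<open>The generator on the Sobolev space\<close>

theorem proposition5p7:
  fixes \<Omega> :: "(real ^ 'n) set"
    and A sqrtA :: "'n sobolev \<Rightarrow> 'n sobolev"
    and G U :: "real \<Rightarrow> 'n sobolev \<Rightarrow> 'n sobolev"
    and S :: "'n sobolev \<Rightarrow> 'n sobolev"
    and domS D :: "'n sobolev set"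
  assumes Omega: "open \<Omega>"
    and A: "positive_op (H10 \<Omega>) A"
           "\<forall>f\<in>H10 \<Omega>. \<forall>g\<in>H10 \<Omega>. cinner (A f) g = L2_inner f g"
    and sqrtA: "positive_sqrt (H10 \<Omega>) A sqrtA"
    and G: "\<forall>t. G t \<in> GG \<Omega>"
           "strongly_continuous_group (H10 \<Omega>) G"
    and U: "\<forall>t. unitary_op (H10 \<Omega>) (U t) \<and> (\<forall>f\<in>H10 \<Omega>. U t (sqrtA f) = sqrtA (G t f))"
    and S: "selfadjoint_op (H10 \<Omega>) domS S"
           "is_exp_i_group (H10 \<Omega>) domS S U"
    and D: "D = cspan {smeared G \<phi> f | \<phi> f. \<phi> \<in> test_functions UNIV \<and> f \<in> H10 \<Omega>}"
  shows "(dense_in (H10 \<Omega>) D \<and>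
          (\<forall>t. G t ` D \<subseteq> D) \<and>
          (\<forall>f\<in>D. \<forall>t. (\<lambda>s. G s f) differentiable (at t))) \<and>
         (dense_in (H10 \<Omega>) (sqrtA ` D) \<and>
          (\<forall>t. U t ` sqrtA ` D \<subseteq> sqrtA ` D) \<and>
          (\<forall>f\<in>sqrtA ` D. \<forall>t. (\<lambda>s. U s f) differentiable (at t))) \<and>
         (S ` sqrtA ` D \<subseteq> sqrtA ` D \<and>
          is_core (sqrtA ` D) domS S \<and>
          (\<forall>f\<in>D. \<i> *\<^sub>C S (sqrtA f) = sqrtA (vector_derivative (\<lambda>t. G t f) (at 0))))"
proof -
  interpret G: operator_group "H10 \<Omega>" G
  proof
    show "closed (H10 \<Omega>)"
      by (simp add: H10_def)
    show "bounded_op (H10 \<Omega>) (G t)" for t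
      using G(1) by (auto simp: GG_def Gl_def)
  qed (rule G(2))
  have D: "D = G.smeared_span"
    by (simp add: D G.smeared_span_def)
  have "bounded_op (H10 \<Omega>) sqrtA"
    using sqrtA by (simp add: positive_sqrt_def positive_op_def)
  moreover have "dense_in (H10 \<Omega>) (sqrtA ` H10 \<Omega>)"
    by (rule positive_sqrt_dense_range[OF A(2) sqrtA])
  moreover have "unitary_op (H10 \<Omega>) (U t)" "f \<in> H10 \<Omega> \<Longrightarrow> U t (sqrtA f) = sqrtA (G t f)" for t f
    using U by auto
  ultimately have *: "bounded_op (H10 \<Omega>) sqrtA" "dense_in (H10 \<Omega>) (sqrtA ` H10 \<Omega>)"
    "\<And>t. unitary_op (H10 \<Omega>) (U t)" "\<And>t f. f \<in> H10 \<Omega> \<Longrightarrow> U t (sqrtA f) = sqrtA (G t f)"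
    "selfadjoint_op (H10 \<Omega>) domS S" "is_exp_i_group (H10 \<Omega>) domS S U"
    using S by auto
  have "(\<lambda>s. G s f) differentiable (at t)" if "f \<in> D" for f t
    using G.smeared_span_differentiable[of f] that differentiableI_vector unfolding D by metis
  moreover have "(\<lambda>s. U s f) differentiable (at t)" if "f \<in> sqrtA ` D" for f t
    using G.image_smeared_span_differentiable[OF *, of f] that differentiableI_vector
    unfolding D by metis
  ultimately show ?thesis
    using G.smeared_span_dense G.smeared_span_invariant G.image_smeared_span_dense[OF *]
      G.image_smeared_span_invariant[OF *] G.generator_intertwined[OF *]
      G.image_smeared_span_is_core[OF *]
    unfolding D by blast
qed

end
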